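(* Let $\mathcal{D}$ be a normal and neutral domain and let $m$ be the number of alternatives. For every $0<\varepsilon_a<1$ and $0<\delta<1/2$ such that $\mathrm{con}_{\mathcal{D}}(\lceil(1-\varepsilon_a)m\rceil)<1$, there exists a $(0,\varepsilon_a,\delta,\mathcal{D})$-Arbitrary Outliers vs Random Profile Tester with sample complexity $$O\left(\log\left(\frac{\log_{1/\varepsilon_a}(1/\delta)}{\delta}\right)\cdot\log_{1/\varepsilon_a}\frac1\delta\cdot\log\log_{1/\varepsilon_a}\frac1\delta\right).$$
   Context: Profiles and domains. Let $\mathcal{A}$ be a finite set of $m$ alternatives and $\mathcal{L}(\mathcal{A})$ the set of linear orders (preferences) over $\mathcal{A}$; for $\mathcal{X}\subseteq\mathcal{A}$, $\succ(\mathcal{X})$ is the restriction of $\succ$ to $\mathcal{X}$. A profile is a tuple $(\succ_i)_{i\in[n]}$ of $n$ preferences over $\mathcal{A}$, one per agent. A domain $\mathcal{D}$ is a collection of subsets of $\bigcup_{|\mathcal{A}|>0}\mathcal{L}(\mathcal{A})$; a profile $\mathcal{P}$ of $n$ preferences belongs to $\mathcal{D}$ (written $\mathcal{P}\in\mathcal{D}$) if there is $\mathcal{B}\in\mathcal{D}$ with $\mathcal{P}\in\mathcal{B}^n$. $\mathcal{D}$ is neutral if membership of profiles in $\mathcal{D}$ is preserved under renaming the alternatives by any permutation (the same for all preferences of the profile). $\mathcal{D}$ is normal if $(\succ_i)_{i\in[n]}\in\mathcal{D}$ implies $(\succ_i(\mathcal{X}))_{i\in[n]}\in\mathcal{D}$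 for every $\mathcal{X}\subseteq\mathcal{A}$. The content of $\mathcal{D}$ is the function $\mathrm{con}_{\mathcal{D}}:\mathbb{N}\to[0,1]$ such that $\mathrm{con}_{\mathcal{D}}(k)\,k!$ is the maximum number of distinct preferences in a profile over $k$ alternatives belonging to $\mathcal{D}$ (with $\mathrm{con}_{\mathcal{D}}(1)=1$). The domain $\mathcal{D}$ is fixed in the $O(\cdot)$ notation. Sampling model. An oracle, when queried, returns an agent picked uniformly at random with replacement from the set of all $n$ agents. The algorithm may then ask this agent arbitrarily many comparison queries: given two alternatives $x,y$, the agent replies which of the two it prefers. The sample complexity of an algorithm is the total number of comparison queries it makes. Problem. A $(0,\varepsilon_a,\delta,\mathcal{D})$-Arbitrary Outliers vs Random Profile Tester is a (randomized) algorithm in this model which, given a profile $(\succ_i)_{i\in[n]}$ over $\mathcal{A}$ that is of one of the following two kinds, outputs $1$ if it is of kind (i) and $0$ if it is of kind (ii), with error probability at most $\delta$: (i) there exists $\mathcal{X}\subseteq\mathcal{A}$ with $|\mathcal{X}|\ge(1-\varepsilon_a)m$ such that $(\succ_i(\mathcal{X}))_{i\in[n]}\in\mathcal{D}$; (ii) for every $i\in[n]$, $\succ_i$ is distributed (independently) uniformly in $\mathcal{L}(\mathcal{A})$. The error probability is over the randomness generating the instance in (ii) and the randomness of the algorithm (including the oracle).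
   Formalization: With L = log_{1/ε_a}(1/δ), correctness is claimed only for n ≥ c·log(L/δ) agents, c depending on D (for n = 1 the claim is false), and L is replaced by max(2, L) in the bound, which otherwise vanishes or is undefined for L ≤ 1. *)

theory Defs
  imports "HOL-Probability.Probability"
begin

section \<open>Preferences, profiles and domains\<close>

text \<open>
  A preference over \<open>A\<close> is a reflexive linear order, and \<open>(x, y) \<in> r\<close> means that \<open>x\<close> is preferred
  to \<open>y\<close> or equal to it. Orders are reflexive rather than strict so that the set of alternatives
  can be read off the relation also when it has just one element.
\<close>

definition linear_orders :: "'a set \<Rightarrow> 'a rel set" where
  "linear_orders A = {r. linear_order_on A r}"

text \<open>
  A profile of \<open>n\<close> preferences is a function on the agents \<open>{..<n}\<close>; its values elsewhere are
  irrelevant.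
\<close>

definition is_profile :: "'a set \<Rightarrow> nat \<Rightarrow> (nat \<Rightarrow> 'a rel) \<Rightarrow> bool" where
  "is_profile A n P \<longleftrightarrow> (\<forall>i<n. P i \<in> linear_orders A)"

definition restrict_profile :: "(nat \<Rightarrow> 'a rel) \<Rightarrow> 'a set \<Rightarrow> nat \<Rightarrow> 'a rel" where
  "restrict_profile P X = (\<lambda>i. Restr (P i) X)"

definition rename_profile :: "('a \<Rightarrow> 'a) \<Rightarrow> (nat \<Rightarrow> 'a rel) \<Rightarrow> nat \<Rightarrow> 'a rel" where
  "rename_profile \<sigma> P = (\<lambda>i. map_prod \<sigma> \<sigma> ` P i)"

definition is_domain :: "'a rel set set \<Rightarrow> bool" where
  "is_domain D \<longleftrightarrow> (\<forall>B\<in>D. B \<subseteq> (\<Union>A\<in>{A. finite A \<and> A \<noteq> {}}. linear_orders A))"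

definition belongs_to :: "'a rel set set \<Rightarrow> nat \<Rightarrow> (nat \<Rightarrow> 'a rel) \<Rightarrow> bool" where
  "belongs_to D n P \<longleftrightarrow> (\<exists>B\<in>D. \<forall>i<n. P i \<in> B)"

definition neutral :: "'a rel set set \<Rightarrow> bool" where
  "neutral D \<longleftrightarrow>
     (\<forall>A n P \<sigma>. finite A \<and> A \<noteq> {} \<and> is_profile A n P \<and> belongs_to D n P \<and> \<sigma> permutes A \<longrightarrow>
        belongs_to D n (rename_profile \<sigma> P))"

text \<open>
  Elements of a domain are orders of nonempty sets, so restrictions to the empty set are excluded.
\<close>

definition normal :: "'a rel set set \<Rightarrow> bool" where
  "normal D \<longleftrightarrow>
     (\<forall>A n P X. finite A \<and> is_profile A n P \<and> belongs_to D n P \<and> X \<subseteq> A \<and> X \<noteq> {} \<longrightarrow>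
        belongs_to D n (restrict_profile P X))"

text \<open>
  The supremum is the maximum of a set of numbers bounded by \<open>fact k\<close>; it is \<open>0\<close> if no profile
  over \<open>k\<close> alternatives belongs to \<open>D\<close>. The value at \<open>1\<close> is fixed to be \<open>1\<close>.
\<close>

definition domain_content :: "'a rel set set \<Rightarrow> nat \<Rightarrow> real" where
  "domain_content D k =
     (if k = 1 then 1
      else real (Sup {card (P ` {..<n}) | A n P.
             finite A \<and> card A = k \<and> is_profile A n P \<and> belongs_to D n P}) / fact k)"

section \<open>Randomized algorithms with a sampling oracle\<close>

text \<open>
  An algorithm is a decision tree. \<open>Toss\<close> uses internal randomness. \<open>Draw\<close> queries the oracle and
  continues with the agent it returns. \<open>Compare x y\<close> asks the agent returned by the latest \<open>Draw\<close>
  whether it prefers \<open>x\<close> to \<open>y\<close>. Nothing else gives access to the profile.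
\<close>

datatype 'a algorithm =
    Output bool
  | Toss "'a algorithm pmf"
  | Draw "nat \<Rightarrow> 'a algorithm"
  | Compare 'a 'a "bool \<Rightarrow> 'a algorithm"

text \<open>
  Joint distribution of the output and the number of comparison queries made. The last argument is
  the preference of the agent being asked; it is empty before the first \<open>Draw\<close>, so that a
  comparison made then is answered without using the profile.
\<close>

primrec run :: "nat \<Rightarrow> (nat \<Rightarrow> 'a rel) \<Rightarrow> 'a algorithm \<Rightarrow> 'a rel \<Rightarrow> (bool \<times> nat) pmf" where
  "run n P (Output b) = (\<lambda>r. return_pmf (b, 0))"
| "run n P (Toss p) = (\<lambda>r. join_pmf (map_pmf (\<lambda>t. run n P t r) p))"
| "run n P (Draw f) = (\<lambda>r. bind_pmf (pmf_of_set {..<n}) (\<lambda>i. run n P (f i) (P i)))"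
| "run n P (Compare x y f) =
     (\<lambda>r. map_pmf (\<lambda>(b, k). (b, Suc k)) (run n P (f ((x, y) \<in> r)) r))"

definition output_dist :: "nat \<Rightarrow> (nat \<Rightarrow> 'a rel) \<Rightarrow> 'a algorithm \<Rightarrow> bool pmf" where
  "output_dist n P T = map_pmf fst (run n P T {})"

definition sample_complexity_le :: "'a set \<Rightarrow> 'a algorithm \<Rightarrow> real \<Rightarrow> bool" where
  "sample_complexity_le A T q \<longleftrightarrow>
     (\<forall>n>0. \<forall>P. is_profile A n P \<longrightarrow> (\<forall>(b, k)\<in>set_pmf (run n P T {}). real k \<le> q))"

section \<open>Arbitrary Outliers vs Random Profile\<close>

definition random_profile :: "'a set \<Rightarrow> nat \<Rightarrow> (nat \<Rightarrow> 'a rel) pmf" where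
  "random_profile A n = Pi_pmf {..<n} {} (\<lambda>_. pmf_of_set (linear_orders A))"

definition outlier_profile ::
    "real \<Rightarrow> 'a rel set set \<Rightarrow> 'a set \<Rightarrow> nat \<Rightarrow> (nat \<Rightarrow> 'a rel) \<Rightarrow> bool" where
  "outlier_profile \<epsilon> D A n P \<longleftrightarrow>
     is_profile A n P \<and>
     (\<exists>X\<subseteq>A. real (card X) \<ge> (1 - \<epsilon>) * real (card A) \<and> belongs_to D n (restrict_profile P X))"

text \<open>
  Correctness is stated for a fixed number \<open>n\<close> of agents because it can only be achieved for \<open>n\<close>
  large enough: if, say, \<open>n = 1\<close> and \<open>D\<close> contains every single preference, then every profile,
  including a random one, is an outlier profile.
\<close>

definition is_tester ::
    "real \<Rightarrow> real \<Rightarrow> 'a rel set set \<Rightarrow> 'a set \<Rightarrow> nat \<Rightarrow> 'a algorithm \<Rightarrow> bool" where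
  "is_tester \<epsilon> \<delta> D A n T \<longleftrightarrow>
     (\<forall>P. outlier_profile \<epsilon> D A n P \<longrightarrow> pmf (output_dist n P T) False \<le> \<delta>) \<and>
     pmf (bind_pmf (random_profile A n) (\<lambda>P. output_dist n P T)) True \<le> \<delta>"

text \<open>
  The quantity \<open>log (1 / \<epsilon>) (1 / \<delta>)\<close> in the complexity bound. Taken literally, the bound tends
  to \<open>0\<close> as this quantity decreases to \<open>1\<close>, and \<open>ln\<close> of it is negative below \<open>1\<close>; it is therefore
  rounded up to \<open>2\<close> where it is smaller.
\<close>

definition log_ratio :: "real \<Rightarrow> real \<Rightarrow> real" where
  "log_ratio \<epsilon> \<delta> = max 2 (log (1 / \<epsilon>) (1 / \<delta>))"

end

theory Submission
  imports Defs
begin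

text \<open>
  Let \<open>k\<close> be the least positive number at which the content is below \<open>1\<close>; it depends on \<open>D\<close> only, and
  the hypothesis gives \<open>k \<le> \<lceil>(1 - \<epsilon>) m\<rceil>\<close>. The tester picks a random set \<open>R\<close> of \<open>O(L)\<close> alternatives,
  \<open>L = log_ratio \<epsilon> \<delta>\<close>, draws \<open>O(ln (L / \<delta>))\<close> agents, sorts \<open>R\<close> according to each of them with
  \<open>O(L ln L)\<close> comparisons, and accepts iff on some \<open>k\<close>-subset of \<open>R\<close> one of the \<open>k!\<close> orders is never
  seen.

  If \<open>X\<close> is the set of non-outliers, every \<open>k\<close>-subset of \<open>R \<inter> X\<close> misses an order by normality, so the
  tester errs only if \<open>R \<inter> X\<close> has fewer than \<open>k\<close> elements. Cut \<open>R\<close> into \<open>k\<close> blocks of size \<open>s\<close>: sampling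
  is without replacement, so a block avoids \<open>X\<close> with probability at most \<open>\<epsilon>\<^sup>s\<close>. For a random profile,
  a union bound over the at most \<open>\<bar>R\<bar>\<^sup>k\<close> pairs of a \<open>k\<close>-subset and an order applies, as each order on each
  \<open>k\<close>-subset is missed with probability exponentially small in the number of drawn agents.
\<close>

section \<open>Linear orders and their restrictions\<close>

lemma linear_orders_subset: "r \<in> linear_orders A \<Longrightarrow> r \<subseteq> A \<times> A"
  by (simp add: linear_orders_def order_on_defs)

lemma finite_linear_orders: "finite A \<Longrightarrow> finite (linear_orders A)"
  using finite_subset[of "linear_orders A" "Pow (A \<times> A)"] linear_orders_subset[of _ A]
  by (simp add: subset_iff)

lemma linear_orders_nonempty: "linear_orders A \<noteq> {}"
proof -
  obtain r where "well_order_on A r"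
    using well_order_on by blast
  then show ?thesis
    unfolding linear_orders_def well_order_on_def by blast
qed

lemma Restr_linear_orders:
  assumes "r \<in> linear_orders A" "Y \<subseteq> A"
  shows "Restr r Y \<in> linear_orders Y"
proof -
  have "r \<subseteq> A \<times> A" "refl_on A r" "trans r" "antisym r" "total_on A r"
    using assms(1) by (auto simp: linear_orders_def order_on_defs)
  then have "refl_on Y (Restr r Y)" "trans (Restr r Y)" "antisym (Restr r Y)" "total_on Y (Restr r Y)"
    using assms(2) trans_Restr[of r Y] antisym_subset[of "Restr r Y" r]
    by (auto simp: refl_on_def total_on_def subset_iff)
  then show ?thesis
    by (simp add: linear_orders_def order_on_defs)
qed

lemma Restr_Restr_subset: "Y \<subseteq> X \<Longrightarrow> Restr (Restr r X) Y = Restr r Y"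
  by auto

section \<open>Renaming the alternatives of an order by a permutation\<close>

lemma mem_image_map_prod_permutes:
  assumes "\<sigma> permutes Y"
  shows "(x, y) \<in> map_prod \<sigma> \<sigma> ` r \<longleftrightarrow> (inv \<sigma> x, inv \<sigma> y) \<in> r"
proof
  assume "(inv \<sigma> x, inv \<sigma> y) \<in> r"
  then have "map_prod \<sigma> \<sigma> (inv \<sigma> x, inv \<sigma> y) \<in> map_prod \<sigma> \<sigma> ` r"
    by (rule imageI)
  then show "(x, y) \<in> map_prod \<sigma> \<sigma> ` r"
    by (simp add: permutes_inverses[OF assms])
next
  assume "(x, y) \<in> map_prod \<sigma> \<sigma> ` r"
  then obtain a b where "(a, b) \<in> r" "x = \<sigma> a" "y = \<sigma> b"
    by auto
  then show "(inv \<sigma> x, inv \<sigma> y) \<in> r"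
    by (simp add: permutes_inverses[OF assms])
qed

lemma image_map_prod_linear_orders:
  assumes "\<sigma> permutes Y" "r \<in> linear_orders Y"
  shows "map_prod \<sigma> \<sigma> ` r \<in> linear_orders Y"
proof -
  have inj: "inv \<sigma> x = inv \<sigma> y \<longleftrightarrow> x = y" for x y
    using permutes_inverses(1)[OF assms(1)] by metis
  have in_Y: "inv \<sigma> x \<in> Y \<longleftrightarrow> x \<in> Y" for x
    using permutes_in_image[OF permutes_inv[OF assms(1)]] .
  have "map_prod \<sigma> \<sigma> ` r \<subseteq> Y \<times> Y"
    using linear_orders_subset[OF assms(2)] permutes_in_image[OF assms(1)] by auto
  moreover have "refl_on Y (map_prod \<sigma> \<sigma> ` r)" "total_on Y (map_prod \<sigma> \<sigma> ` r)"
    using assms(2) in_Y inj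
    unfolding refl_on_def total_on_def mem_image_map_prod_permutes[OF assms(1)]
    by (auto simp: linear_orders_def order_on_defs refl_on_def total_on_def)
  moreover have "trans (map_prod \<sigma> \<sigma> ` r)"
    using assms(2) unfolding linear_orders_def order_on_defs
      trans_def mem_image_map_prod_permutes[OF assms(1)] by blast
  moreover have "antisym (map_prod \<sigma> \<sigma> ` r)"
    using assms(2) inj unfolding linear_orders_def order_on_defs
      antisym_def mem_image_map_prod_permutes[OF assms(1)] by blast
  ultimately show ?thesis
    unfolding linear_orders_def order_on_defs by (intro CollectI conjI)
qed

lemma well_order_on_linear_orders:
  assumes "finite Y" "r \<in> linear_orders Y"
  shows "well_order_on Y r"
proof -
  have "finite r"
    using linear_orders_subset[OF assms(2)] assms(1) by (meson finite_SigmaI finite_subset)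
  then show ?thesis
    using assms(2) linear_order_on_well_order_on unfolding linear_orders_def by blast
qed

text \<open>Finite linear orders are well-orders. Two well-orders of the same finite set are
  isomorphic, which gives surjectivity, and the isomorphism is unique, which gives injectivity. This
  is how the number of orders comes out as \<open>fact (card Y)\<close>.\<close>

lemma bij_betw_permutations_linear_orders:
  assumes "finite Y" "r \<in> linear_orders Y"
  shows "bij_betw (\<lambda>\<sigma>. map_prod \<sigma> \<sigma> ` r) {\<sigma>. \<sigma> permutes Y} (linear_orders Y)"
  unfolding bij_betw_def
proof
  note wo = well_order_on_linear_orders[OF assms(1)]
  show "inj_on (\<lambda>\<sigma>. map_prod \<sigma> \<sigma> ` r) {\<sigma>. \<sigma> permutes Y}"
  proof (rule inj_onI)
    fix \<sigma> \<tau>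
    assume "\<sigma> \<in> {\<sigma>. \<sigma> permutes Y}" "\<tau> \<in> {\<sigma>. \<sigma> permutes Y}"
      and eq: "map_prod \<sigma> \<sigma> ` r = map_prod \<tau> \<tau> ` r"
    then have \<sigma>: "\<sigma> permutes Y" and \<tau>: "\<tau> permutes Y"
      by auto
    define r' where "r' = map_prod \<sigma> \<sigma> ` r"
    have r': "r' \<in> linear_orders Y"
      unfolding r'_def by (rule image_map_prod_linear_orders[OF \<sigma> assms(2)])
    have W: "Well_order r" "Field r = Y" "Well_order r'" "Field r' = Y"
      using well_order_on_Well_order[OF wo[OF assms(2)]] well_order_on_Well_order[OF wo[OF r']]
      by auto
    have iso: "iso r r' \<rho>" if "\<rho> permutes Y" "r' = map_prod \<rho> \<rho> ` r" for \<rho>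
      unfolding iso_iff2 W that(2) mem_image_map_prod_permutes[OF that(1)]
      using permutes_imp_bij[OF that(1)] W that permutes_inverses[OF that(1)] by simp
    \<comment> \<open>Both permutations carry \<open>r\<close> to \<open>r'\<close>, so both are
      isomorphisms and agree on \<open>Y\<close>; outside \<open>Y\<close> both are the
      identity.\<close>
    have "\<sigma> a = \<tau> a" if "a \<in> Y" for a
      using embed_unique[OF W(1,3)] iso[OF \<sigma> r'_def] iso[OF \<tau>] eq that W(2)
      unfolding iso_def r'_def by blast
    then show "\<sigma> = \<tau>"
      using permutes_not_in[OF \<sigma>] permutes_not_in[OF \<tau>] by (intro ext) metis
  qed
  show "(\<lambda>\<sigma>. map_prod \<sigma> \<sigma> ` r) ` {\<sigma>. \<sigma> permutes Y} = linear_orders Y"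
  proof (intro equalityI subsetI)
    fix r' assume r': "r' \<in> linear_orders Y"
    have W: "Field r = Y" "Field r' = Y"
      using well_order_on_Well_order[OF wo[OF assms(2)]] well_order_on_Well_order[OF wo[OF r']]
      by auto
    obtain f where "iso r r' f"
      using finite_well_order_on_ordIso[OF assms(1) wo[OF assms(2)] wo[OF r']]
      unfolding ordIso_def by blast
    then have f: "bij_betw f Y Y" "\<And>a b. a \<in> Y \<Longrightarrow> b \<in> Y \<Longrightarrow> (a, b) \<in> r \<longleftrightarrow> (f a, f b) \<in> r'"
      unfolding iso_iff2 W by auto
    \<comment> \<open>The isomorphism matters only on \<open>Y\<close>, while a permutation of
      \<open>Y\<close> has to fix all other points.\<close>
    define \<sigma> where "\<sigma> = (\<lambda>a. if a \<in> Y then f a else a)"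
    have "bij_betw \<sigma> Y Y"
      using f(1) by (subst bij_betw_cong[of _ _ f]) (auto simp: \<sigma>_def)
    then have \<sigma>: "\<sigma> permutes Y"
      by (rule bij_imp_permutes) (auto simp: \<sigma>_def)
    have "map_prod \<sigma> \<sigma> ` r \<subseteq> r'"
      using linear_orders_subset[OF assms(2)] f(2) by (auto simp: \<sigma>_def)
    moreover have "r' \<subseteq> map_prod \<sigma> \<sigma> ` r"
    proof (rule subrelI)
      fix x y assume xy: "(x, y) \<in> r'"
      then have "x \<in> f ` Y" "y \<in> f ` Y"
        using linear_orders_subset[OF r'] bij_betw_imp_surj_on[OF f(1)] by auto
      then obtain a b where "a \<in> Y" "b \<in> Y" "x = f a" "y = f b"
        by auto
      then show "(x, y) \<in> map_prod \<sigma> \<sigma> ` r"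
        using f(2) xy by (intro image_eqI[of _ _ "(a, b)"]) (auto simp: \<sigma>_def)
    qed
    ultimately show "r' \<in> (\<lambda>\<sigma>. map_prod \<sigma> \<sigma> ` r) ` {\<sigma>. \<sigma> permutes Y}"
      using \<sigma> by blast
  qed (auto intro: image_map_prod_linear_orders assms(2))
qed

lemma card_linear_orders:
  assumes "finite Y"
  shows "card (linear_orders Y) = fact (card Y)"
proof -
  obtain r where "r \<in> linear_orders Y"
    using linear_orders_nonempty by blast
  from bij_betw_same_card[OF bij_betw_permutations_linear_orders[OF assms this]] show ?thesis
    using card_permutations[OF refl assms] by simp
qed

text \<open>A permutation of \<open>Y\<close> taking \<open>\<omega>\<close> to
  \<open>\<omega>'\<close> fixes the rest of \<open>A\<close>, so renaming by it maps one fibre of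
  the restriction injectively into the other. Exchanging the two orders shows that all fibres have
  the same size.\<close>

lemma card_linear_orders_Restr_le:
  assumes "finite A" "Y \<subseteq> A" "\<omega> \<in> linear_orders Y" "\<omega>' \<in> linear_orders Y"
  shows "card {r \<in> linear_orders A. Restr r Y = \<omega>} \<le> card {r \<in> linear_orders A. Restr r Y = \<omega>'}"
proof -
  have "finite Y"
    using assms(1,2) finite_subset by blast
  then obtain \<sigma> where \<sigma>: "\<sigma> permutes Y" and eq: "\<omega>' = map_prod \<sigma> \<sigma> ` \<omega>"
    using bij_betw_imp_surj_on[OF bij_betw_permutations_linear_orders[OF _ assms(3)]] assms(4)
    by blast
  have \<sigma>A: "\<sigma> permutes A"
    using permutes_subset[OF \<sigma> assms(2)] .
  have "Restr (map_prod \<sigma> \<sigma> ` r) Y = map_prod \<sigma> \<sigma> ` Restr r Y" for r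
    using permutes_in_image[OF \<sigma>] by auto
  then have "(\<lambda>r. map_prod \<sigma> \<sigma> ` r) ` {r \<in> linear_orders A. Restr r Y = \<omega>}
      \<subseteq> {r \<in> linear_orders A. Restr r Y = \<omega>'}"
    using image_map_prod_linear_orders[OF \<sigma>A] eq by auto
  moreover have "inj_on (\<lambda>r. map_prod \<sigma> \<sigma> ` r) {r \<in> linear_orders A. Restr r Y = \<omega>}"
    using inj_image_eq_iff[OF prod.inj_map] permutes_inj[OF \<sigma>] by (meson inj_onI)
  ultimately show ?thesis
    using finite_linear_orders[OF assms(1)] by (intro card_inj_on_le[where f = "(`) (map_prod \<sigma> \<sigma>)"]) auto
qed

text \<open>Restriction to \<open>Y\<close> splits \<open>linear_orders A\<close> into
  \<open>fact (card Y)\<close> fibres of equal size, so a uniform order of \<open>A\<close> induces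
  a uniform order of \<open>Y\<close>.\<close>

lemma prob_linear_orders_Restr:
  assumes "finite A" "Y \<subseteq> A" "\<omega> \<in> linear_orders Y"
  shows "measure_pmf.prob (pmf_of_set (linear_orders A)) {r. Restr r Y = \<omega>} = 1 / fact (card Y)"
proof -
  let ?F = "\<lambda>\<omega>. {r \<in> linear_orders A. Restr r Y = \<omega>}"
  have fin: "finite Y" "finite (linear_orders A)"
    using finite_subset[OF assms(2,1)] finite_linear_orders[OF assms(1)] .
  have "card (linear_orders A) = card (\<Union>\<omega>'\<in>linear_orders Y. ?F \<omega>')"
    using Restr_linear_orders[OF _ assms(2)] by (intro arg_cong[where f = card]) blast
  also have "\<dots> = (\<Sum>\<omega>'\<in>linear_orders Y. card (?F \<omega>'))"
    using fin finite_linear_orders[OF fin(1)] by (intro card_UN_disjoint) auto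
  also have "\<dots> = (\<Sum>\<omega>'\<in>linear_orders Y. card (?F \<omega>))"
    by (intro sum.cong refl antisym card_linear_orders_Restr_le assms)
  finally have eq: "real (card (linear_orders A)) = fact (card Y) * real (card (?F \<omega>))"
    using card_linear_orders[OF fin(1)] by simp
  moreover have "card (?F \<omega>) \<noteq> 0"
    using eq card_linear_orders[OF assms(1)] by (intro notI) simp
  moreover have "linear_orders A \<inter> {r. Restr r Y = \<omega>} = ?F \<omega>"
    by blast
  ultimately show ?thesis
    using measure_pmf_of_set[OF linear_orders_nonempty fin(2), of "{r. Restr r Y = \<omega>}"]
    by simp
qed

section \<open>Learning an order by comparisons\<close>

text \<open>
  Binary insertion. The continuation takes the place of a return value, so that the queries of
  successive insertions are composed into one decision tree.
\<close>

function insert_query :: "'a \<Rightarrow> 'a list \<Rightarrow> ('a list \<Rightarrow> 'a algorithm) \<Rightarrow> 'a algorithm" where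
  "insert_query x ys K =
     (if ys = [] then K [x]
      else let h = length ys div 2 in
        Compare x (ys ! h) (\<lambda>b.
          if b then insert_query x (take h ys) (\<lambda>zs. K (zs @ drop h ys))
          else insert_query x (drop (Suc h) ys) (\<lambda>zs. K (take (Suc h) ys @ zs))))"
  by pat_completeness auto
termination
  by (relation "Wellfounded.measure (\<lambda>(x, ys, K). length ys)") auto

declare insert_query.simps [simp del]

primrec sort_query :: "'a list \<Rightarrow> ('a list \<Rightarrow> 'a algorithm) \<Rightarrow> 'a algorithm" where
  "sort_query [] K = K []"
| "sort_query (x # xs) K = sort_query xs (\<lambda>ys. insert_query x ys K)"

abbreviation sorted_by :: "'a rel \<Rightarrow> 'a list \<Rightarrow> bool" where
  "sorted_by r \<equiv> sorted_wrt (\<lambda>x y. (x, y) \<in> r)"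

abbreviation add_cost :: "nat \<Rightarrow> (bool \<times> nat) pmf \<Rightarrow> (bool \<times> nat) pmf" where
  "add_cost c \<equiv> map_pmf (\<lambda>(b, k). (b, k + c))"

lemma add_cost_add_cost: "add_cost c (add_cost d p) = add_cost (d + c) p"
  by (simp add: pmf.map_comp o_def case_prod_unfold add.assoc)

lemma map_fst_add_cost: "map_pmf fst (add_cost c p) = map_pmf fst p"
  by (simp add: pmf.map_comp o_def case_prod_unfold)

text \<open>A comparison with the middle element halves the bound on the length, hence at most
  \<open>d\<close> comparisons. The conclusion is an equation between runs with an arbitrary
  continuation, so that the costs of consecutive insertions add up.\<close>

lemma run_insert_query:
  assumes r: "r \<in> linear_orders A" and "insert x (set ys) \<subseteq> A" "sorted_by r ys"
    and "length ys < 2 ^ d"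
  shows "\<exists>zs c. c \<le> d \<and> sorted_by r zs \<and> set zs = insert x (set ys) \<and>
    length zs = Suc (length ys) \<and>
    run n P (insert_query x ys K) r = add_cost c (run n P (K zs) r)"
  using assms(2-)
proof (induction d arbitrary: ys K)
  case 0
  then show ?case
    by (intro exI[of _ "[x]"] exI[of _ 0]) (simp add: insert_query.simps)
next
  case (Suc d)
  show ?case
  proof (cases "ys = []")
    case True
    then show ?thesis
      by (intro exI[of _ "[x]"] exI[of _ 0]) (simp add: insert_query.simps)
  next
    case False
    define h where "h = length ys div 2"
    have h: "h < length ys"
      using False by (simp add: h_def)
    have split: "ys = take h ys @ ys ! h # drop (Suc h) ys"
      using h by (simp add: id_take_nth_drop)
    have len: "length (take h ys) < 2 ^ d" "length (drop (Suc h) ys) < 2 ^ d"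
      using Suc.prems(3) h unfolding h_def by auto
    have sub: "set (take h ys) \<subseteq> set ys" "set (drop (Suc h) ys) \<subseteq> set ys" "set (drop h ys) \<subseteq> set ys"
      "set (take (Suc h) ys) \<subseteq> set ys" "ys ! h \<in> set ys"
      using h by (auto dest: in_set_takeD in_set_dropD)
    have srt: "sorted_by r (take h ys)" "sorted_by r (drop (Suc h) ys)"
      "sorted_by r (take (Suc h) ys)" "sorted_by r (drop h ys)"
      using Suc.prems(2) by (auto intro: sorted_wrt_take sorted_wrt_drop)
    have trans: "(a, c) \<in> r" if "(a, b) \<in> r" "(b, c) \<in> r" for a b c
      using r that by (auto simp: linear_orders_def order_on_defs dest: transD)
    have refl: "(a, a) \<in> r" if "a \<in> A" for a
      using r that by (auto simp: linear_orders_def order_on_defs refl_on_def)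
    have total: "(a, b) \<in> r \<or> (b, a) \<in> r" if "a \<in> A" "b \<in> A" for a b
      using r that refl[of b]
      by (cases "a = b") (auto simp: linear_orders_def order_on_defs total_on_def)
    \<comment> \<open>The pivot lies in both \<open>drop h ys\<close> and
      \<open>take (Suc h) ys\<close>, so \<open>mid\<close> and \<open>mid'\<close> include its
      comparison with itself.\<close>
    have hA: "(ys ! h, ys ! h) \<in> r"
      using refl sub(5) Suc.prems(1) by blast
    have mid: "(ys ! h, b) \<in> r" if "b \<in> set (drop h ys)" for b
      using that srt(4) hA h by (auto simp flip: Cons_nth_drop_Suc)
    have mid': "(b, ys ! h) \<in> r" if "b \<in> set (take (Suc h) ys)" for b
      using that srt(3) hA h
      by (auto simp: take_Suc_conv_app_nth sorted_wrt_append)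
    have cross: "(a, b) \<in> r" if "a \<in> set (take i ys)" "b \<in> set (drop i ys)" for a b i
      using Suc.prems(2) sorted_wrt_append[of "\<lambda>x y. (x, y) \<in> r" "take i ys" "drop i ys"] that
      by simp
    show ?thesis
    proof (cases "(x, ys ! h) \<in> r")
      case True
      obtain zs c where zs: "c \<le> d" "sorted_by r zs" "set zs = insert x (set (take h ys))"
        "length zs = Suc (length (take h ys))"
        "run n P (insert_query x (take h ys) (\<lambda>zs. K (zs @ drop h ys))) r
           = add_cost c (run n P (K (zs @ drop h ys)) r)"
        using Suc.IH[OF _ srt(1) len(1), of "\<lambda>zs. K (zs @ drop h ys)"] Suc.prems(1) sub(1) by blast
      have "sorted_by r (zs @ drop h ys)"
        using zs(2,3) srt(4) cross trans[OF True] mid by (auto simp: sorted_wrt_append)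
      moreover have "set (zs @ drop h ys) = insert x (set ys)"
        using zs(3) by (metis append_take_drop_id set_append insert_is_Un sup_assoc)
      moreover have "run n P (insert_query x ys K) r = add_cost (Suc c) (run n P (K (zs @ drop h ys)) r)"
        using False True zs(5) add_cost_add_cost[of 1 c]
        by (subst insert_query.simps) (simp add: Let_def h_def)
      ultimately show ?thesis
        using zs(1,4) h by (intro exI[of _ "zs @ drop h ys"] exI[of _ "Suc c"]) simp
    next
      case False2: False
      have less: "(ys ! h, x) \<in> r"
        using total[of x "ys ! h"] False2 sub(5) Suc.prems(1) by blast
      obtain zs c where zs: "c \<le> d" "sorted_by r zs" "set zs = insert x (set (drop (Suc h) ys))"
        "length zs = Suc (length (drop (Suc h) ys))"
        "run n P (insert_query x (drop (Suc h) ys) (\<lambda>zs. K (take (Suc h) ys @ zs))) r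
           = add_cost c (run n P (K (take (Suc h) ys @ zs)) r)"
        using Suc.IH[OF _ srt(2) len(2), of "\<lambda>zs. K (take (Suc h) ys @ zs)"] Suc.prems(1) sub(2)
        by blast
      have "sorted_by r (take (Suc h) ys @ zs)"
        using zs(2,3) srt(3) cross trans[OF _ less] mid' by (auto simp: sorted_wrt_append)
      moreover have "set (take (Suc h) ys @ zs) = insert x (set ys)"
        using zs(3) by (metis append_take_drop_id set_append Un_insert_right)
      moreover have "run n P (insert_query x ys K) r
          = add_cost (Suc c) (run n P (K (take (Suc h) ys @ zs)) r)"
        using False False2 zs(5) add_cost_add_cost[of 1 c]
        by (subst insert_query.simps) (simp add: Let_def h_def)
      ultimately show ?thesis
        using zs(1,4) h by (intro exI[of _ "take (Suc h) ys @ zs"] exI[of _ "Suc c"]) simp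
    qed
  qed
qed

text \<open>Each element is inserted into a list strictly shorter than the whole, hence of length
  below \<open>2 ^ d\<close>, at cost at most \<open>d\<close>.\<close>

lemma run_sort_query:
  assumes r: "r \<in> linear_orders A" and "set xs \<subseteq> A" "length xs \<le> 2 ^ d"
  shows "\<exists>zs c. c \<le> length xs * d \<and> sorted_by r zs \<and> set zs = set xs \<and> length zs = length xs \<and>
    run n P (sort_query xs K) r = add_cost c (run n P (K zs) r)"
  using assms(2,3)
proof (induction xs arbitrary: K)
  case Nil
  then show ?case
    by (intro exI[of _ "[]"] exI[of _ 0]) simp
next
  case (Cons x xs)
  obtain ys c where ys: "c \<le> length xs * d" "sorted_by r ys" "set ys = set xs"
    "length ys = length xs"
    "run n P (sort_query xs (\<lambda>ys. insert_query x ys K)) r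
       = add_cost c (run n P (insert_query x ys K) r)"
    using Cons.IH[of "\<lambda>ys. insert_query x ys K"] Cons.prems by auto
  obtain zs c' where zs: "c' \<le> d" "sorted_by r zs" "set zs = insert x (set ys)"
    "length zs = Suc (length ys)"
    "run n P (insert_query x ys K) r = add_cost c' (run n P (K zs) r)"
    using run_insert_query[OF r _ ys(2), of x d n P K] Cons.prems ys(3,4) by auto
  show ?case
    using ys zs by (intro exI[of _ zs] exI[of _ "c' + c"]) (simp add: add_cost_add_cost)
qed

section \<open>From comparison answers to restricted preferences\<close>

definition list_rel :: "'a list \<Rightarrow> 'a rel" where
  "list_rel zs = {(zs ! i, zs ! j) | i j. i \<le> j \<and> j < length zs}"

text \<open>Sortedness supplies the pairs with \<open>i < j\<close> and reflexivity those with
  \<open>i = j\<close>. Conversely, a pair of \<open>r\<close> whose positions are in the wrong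
  order has equal components by antisymmetry.\<close>

lemma list_rel_eq_Restr:
  assumes r: "r \<in> linear_orders A" and zs: "set zs \<subseteq> A" "sorted_by r zs"
  shows "list_rel zs = Restr r (set zs)"
proof (intro equalityI subrelI)
  have refl: "(a, a) \<in> r" if "a \<in> A" for a
    using r that by (auto simp: linear_orders_def order_on_defs refl_on_def)
  have sub: "(zs ! i, zs ! j) \<in> r" if "i \<le> j" "j < length zs" for i j
    using that zs(1) refl[of "zs ! j"] sorted_wrt_nth_less[OF zs(2), of i j]
    by (cases "i = j") (auto simp: subset_iff)
  fix x y
  {
    assume "(x, y) \<in> list_rel zs"
    then show "(x, y) \<in> Restr r (set zs)"
      using sub by (auto simp: list_rel_def)
  next
    assume xy: "(x, y) \<in> Restr r (set zs)"
    then obtain i j where ij: "i < length zs" "j < length zs" "x = zs ! i" "y = zs ! j"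
      by (auto simp: in_set_conv_nth)
    show "(x, y) \<in> list_rel zs"
    proof (cases "i \<le> j")
      case False
      then have "(y, x) \<in> r"
        using sub[of j i] ij by simp
      then have "x = y"
        using xy r by (auto simp: linear_orders_def order_on_defs antisym_def)
      then show ?thesis
        using ij by (auto simp: list_rel_def)
    qed (use ij in \<open>auto simp: list_rel_def\<close>)
  }
qed

text \<open>\<open>W\<close> collects the orders of the sample seen so far. A set suffices because
  the verdict depends only on which orders occur, not on how often or from which agent.\<close>

primrec sample_query ::
    "'a list \<Rightarrow> ('a rel set \<Rightarrow> bool) \<Rightarrow> nat \<Rightarrow> 'a rel set \<Rightarrow> 'a algorithm" where
  "sample_query xs Q 0 W = Output (Q W)"
| "sample_query xs Q (Suc q) W =
     Draw (\<lambda>_. sort_query xs (\<lambda>zs. sample_query xs Q q (insert (list_rel zs) W)))"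

text \<open>Hides the sorted list: from here on, a round adds the restriction of the drawn
  preference to \<open>W\<close> at bounded cost.\<close>

lemma sample_query_Suc_step:
  assumes "is_profile A n P" "set xs \<subseteq> A" "length xs \<le> 2 ^ d" "i < n"
  obtains c where "c \<le> length xs * d"
    "run n P (sort_query xs (\<lambda>zs. sample_query xs Q q (insert (list_rel zs) W))) (P i)
       = add_cost c (run n P (sample_query xs Q q (insert (Restr (P i) (set xs)) W)) (P i))"
proof -
  have Pi: "P i \<in> linear_orders A"
    using assms by (simp add: is_profile_def)
  from run_sort_query[OF Pi assms(2,3), of n P
      "\<lambda>zs. sample_query xs Q q (insert (list_rel zs) W)"]
  obtain zs c where "c \<le> length xs * d" "sorted_by (P i) zs" "set zs = set xs"
    "run n P (sort_query xs (\<lambda>zs. sample_query xs Q q (insert (list_rel zs) W))) (P i)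
       = add_cost c (run n P (sample_query xs Q q (insert (list_rel zs) W)) (P i))"
    by auto
  moreover from this have "list_rel zs = Restr (P i) (set xs)"
    using list_rel_eq_Restr[OF Pi, of zs] assms(2) by simp
  ultimately show thesis
    using that by simp
qed

lemma sample_query_cost:
  assumes "is_profile A n P" "set xs \<subseteq> A" "length xs \<le> 2 ^ d" "n > 0"
    and "(b, k) \<in> set_pmf (run n P (sample_query xs Q q W) r)"
  shows "k \<le> q * (length xs * d)"
  using assms(5)
proof (induction q arbitrary: W r b k)
  case (Suc q)
  then obtain i where i: "i < n" and
    mem: "(b, k) \<in> set_pmf (run n P
      (sort_query xs (\<lambda>zs. sample_query xs Q q (insert (list_rel zs) W))) (P i))"
    using assms(4) by (auto simp: set_pmf_of_set lessThan_empty_iff)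
  obtain c where "c \<le> length xs * d"
    "run n P (sort_query xs (\<lambda>zs. sample_query xs Q q (insert (list_rel zs) W))) (P i)
       = add_cost c (run n P (sample_query xs Q q (insert (Restr (P i) (set xs)) W)) (P i))"
    using sample_query_Suc_step[OF assms(1-3) i] .
  then show ?case
    using mem Suc.IH by fastforce
qed simp

text \<open>Each round starts with a new \<open>Draw\<close>, so the preference held before it does
  not influence the output, and forgetting the costs leaves \<open>q\<close> independent uniform
  agents.\<close>

lemma sample_query_output:
  assumes "is_profile A n P" "set xs \<subseteq> A" "n > 0"
  shows "map_pmf fst (run n P (sample_query xs Q q W) r) =
    map_pmf (\<lambda>js. Q ((\<lambda>i. Restr (P i) (set xs)) ` set js \<union> W))
      (replicate_pmf q (pmf_of_set {..<n}))"
proof (induction q arbitrary: W r)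
  case (Suc q)
  \<comment> \<open>The exponent matters only for the cost, which is projected away, so any
    admissible one will do.\<close>
  have "length xs \<le> 2 ^ length xs"
    by (simp add: less_imp_le)
  have step: "map_pmf fst (run n P
      (sort_query xs (\<lambda>zs. sample_query xs Q q (insert (list_rel zs) W))) (P i)) =
    map_pmf (\<lambda>js. Q ((\<lambda>i. Restr (P i) (set xs)) ` set (i # js) \<union> W))
      (replicate_pmf q (pmf_of_set {..<n}))" if "i < n" for i
  proof -
    obtain c where "run n P (sort_query xs (\<lambda>zs. sample_query xs Q q (insert (list_rel zs) W))) (P i)
       = add_cost c (run n P (sample_query xs Q q (insert (Restr (P i) (set xs)) W)) (P i))"
      using sample_query_Suc_step[OF assms(1,2) _ \<open>i < n\<close>, of "length xs"] \<open>length xs \<le> 2 ^ length xs\<close>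
      by blast
    then show ?thesis
      by (simp only: map_fst_add_cost Suc.IH) simp
  qed
  have set: "set_pmf (pmf_of_set {..<n}) = {..<n}"
    using assms(3) by (intro set_pmf_of_set) (auto simp: lessThan_empty_iff)
  have "map_pmf fst (run n P (sample_query xs Q (Suc q) W) r) =
    bind_pmf (pmf_of_set {..<n}) (\<lambda>i. map_pmf fst (run n P
      (sort_query xs (\<lambda>zs. sample_query xs Q q (insert (list_rel zs) W))) (P i)))"
    by (simp add: map_bind_pmf)
  also have "\<dots> = bind_pmf (pmf_of_set {..<n}) (\<lambda>i.
    map_pmf (\<lambda>js. Q ((\<lambda>i. Restr (P i) (set xs)) ` set (i # js) \<union> W))
      (replicate_pmf q (pmf_of_set {..<n})))"
    by (rule bind_pmf_cong[OF refl]) (rule step, simp add: set)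
  also have "\<dots> = map_pmf (\<lambda>js. Q ((\<lambda>i. Restr (P i) (set xs)) ` set js \<union> W))
      (replicate_pmf (Suc q) (pmf_of_set {..<n}))"
    by (simp add: map_pmf_def bind_assoc_pmf bind_return_pmf)
  finally show ?case .
qed simp

section \<open>Random samples of alternatives and agents\<close>

text \<open>
  Double counting of the pairs of \<open>c \<in> A\<close> and \<open>\<sigma>\<close> with \<open>\<sigma> ` B \<subseteq> Z\<close> and \<open>\<sigma> c \<in> Z\<close>: exchanging \<open>b\<close> and
  \<open>c\<close> shows that no \<open>c\<close> admits fewer \<open>\<sigma>\<close> than \<open>b\<close>.
\<close>

lemma card_permutations_image_insert_le:
  assumes "finite A" "b \<in> A" "b \<notin> B" "Z \<subseteq> A"
  shows "card A * card {\<sigma>. \<sigma> permutes A \<and> \<sigma> ` insert b B \<subseteq> Z}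
    \<le> card Z * card {\<sigma>. \<sigma> permutes A \<and> \<sigma> ` B \<subseteq> Z}"
proof -
  define S where "S = {\<sigma>. \<sigma> permutes A \<and> \<sigma> ` B \<subseteq> Z}"
  define T where "T = (\<lambda>c. {\<sigma> \<in> S. \<sigma> c \<in> Z})"
  have fin: "finite S"
    using finite_permutations[OF assms(1)] by (rule finite_subset[rotated]) (auto simp: S_def)
  have finT: "finite (T c)" for c
    using fin by (simp add: T_def)
  have T_le: "card (T b) \<le> card (T c)" if "c \<in> A" for c
  proof (cases "c \<in> B")
    case True
    then show ?thesis
      using finT by (intro card_mono) (auto simp: T_def S_def)
  next
    case False
    have "(\<lambda>\<sigma>. \<sigma> \<circ> Transposition.transpose b c) ` T b \<subseteq> T c"
    proof (intro image_subsetI)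
      fix \<sigma> assume \<sigma>: "\<sigma> \<in> T b"
      have "\<sigma> \<circ> Transposition.transpose b c permutes A"
        using \<sigma> assms(2) that by (intro permutes_compose permutes_swap_id) (auto simp: T_def S_def)
      moreover have "(\<sigma> \<circ> Transposition.transpose b c) x = \<sigma> x" if "x \<in> B" for x
        using that False assms(3) by (auto simp: Transposition.transpose_def)
      ultimately show "\<sigma> \<circ> Transposition.transpose b c \<in> T c"
        using \<sigma> by (auto simp: T_def S_def)
    qed
    moreover have "inj_on (\<lambda>\<sigma>. \<sigma> \<circ> Transposition.transpose b c) (T b)"
      by (rule inj_on_inverseI[where g = "\<lambda>\<sigma>. \<sigma> \<circ> Transposition.transpose b c"]) (simp add: o_assoc[symmetric])
    ultimately show ?thesis
      using card_inj_on_le finT by blast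
  qed
  have "card A * card (T b) \<le> (\<Sum>c\<in>A. card (T c))"
    using sum_bounded_below[of A "card (T b)" "\<lambda>c. card (T c)"] T_le by simp
  also have "\<dots> = (\<Sum>c\<in>A. \<Sum>\<sigma>\<in>S. if \<sigma> c \<in> Z then 1 else 0)"
    using fin by (intro sum.cong refl) (simp add: T_def sum.If_cases Int_def)
  also have "\<dots> = (\<Sum>\<sigma>\<in>S. \<Sum>c\<in>A. if \<sigma> c \<in> Z then 1 else 0)"
    by (rule sum.swap)
  also have "\<dots> = (\<Sum>\<sigma>\<in>S. card Z)"
  proof (intro sum.cong refl)
    fix \<sigma> assume "\<sigma> \<in> S"
    then have \<sigma>: "\<sigma> permutes A"
      by (simp add: S_def)
    have "\<sigma> ` {c \<in> A. \<sigma> c \<in> Z} = Z"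
      using permutes_image[OF \<sigma>] assms(4) by auto
    then have "card {c \<in> A. \<sigma> c \<in> Z} = card Z"
      using card_image[OF permutes_inj_on[OF \<sigma>]] by metis
    then show "(\<Sum>c\<in>A. if \<sigma> c \<in> Z then 1 else 0) = card Z"
      using assms(1) by (simp add: sum.If_cases Int_def)
  qed
  also have "\<dots> = card Z * card S"
    by simp
  also have "T b = {\<sigma>. \<sigma> permutes A \<and> \<sigma> ` insert b B \<subseteq> Z}"
    by (auto simp: T_def S_def)
  finally show ?thesis
    by (simp add: S_def)
qed

text \<open>Each element added to \<open>B\<close> multiplies the count by at most
  \<open>card Z / card A\<close>: the image of a fixed set under a random permutation is a sample
  without replacement, which is no more likely to stay inside \<open>Z\<close> than one with
  replacement. The induction is multiplied through to stay in the natural numbers.\<close>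

lemma prob_permutation_image_subset:
  assumes "finite A" "A \<noteq> {}" "B \<subseteq> A" "Z \<subseteq> A"
  shows "measure_pmf.prob (pmf_of_set {\<sigma>. \<sigma> permutes A}) {\<sigma>. \<sigma> ` B \<subseteq> Z}
    \<le> (real (card Z) / real (card A)) ^ card B"
proof -
  let ?N = "\<lambda>B. card {\<sigma>. \<sigma> permutes A \<and> \<sigma> ` B \<subseteq> Z}"
  have "finite B"
    using assms(1,3) finite_subset by blast
  then have "card A ^ card B * ?N B \<le> card Z ^ card B * ?N {}"
    using assms(3)
  proof (induction B)
    case (insert b B)
    have "card A ^ card (insert b B) * ?N (insert b B) = card A ^ card B * (card A * ?N (insert b B))"
      using insert.hyps by simp
    also have "\<dots> \<le> card A ^ card B * (card Z * ?N B)"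
      using card_permutations_image_insert_le[OF assms(1) _ insert.hyps(2) assms(4)] insert.prems
      by (intro mult_left_mono) auto
    also have "\<dots> = card Z * (card A ^ card B * ?N B)"
      by simp
    also have "\<dots> \<le> card Z * (card Z ^ card B * ?N {})"
      using insert by (intro mult_left_mono) auto
    finally show ?case
      using insert.hyps by (simp add: mult.assoc)
  qed simp
  then have le: "real (card A ^ card B * ?N B) \<le> real (card Z ^ card B * ?N {})"
    by (rule of_nat_mono)
  have ne: "{\<sigma>. \<sigma> permutes A} \<noteq> {}" "finite {\<sigma>. \<sigma> permutes A}"
    using permutes_id finite_permutations[OF assms(1)] by blast+
  have pos: "card A > 0" "card {\<sigma>. \<sigma> permutes A} > 0"
    using assms(1,2) ne by (auto simp: card_gt_0_iff)
  have "measure_pmf.prob (pmf_of_set {\<sigma>. \<sigma> permutes A}) {\<sigma>. \<sigma> ` B \<subseteq> Z}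
      = real (?N B) / real (card {\<sigma>. \<sigma> permutes A})"
    using measure_pmf_of_set[OF ne] by (simp add: Collect_conj_eq)
  also have "\<dots> \<le> (real (card Z) / real (card A)) ^ card B"
    using le pos by (simp add: field_simps)
  finally show ?thesis .
qed

section \<open>Fixed blocks moved by a random permutation\<close>

lemma exists_disjoint_blocks:
  assumes "k * s \<le> card A"
  obtains B where "\<forall>j<k. B j \<subseteq> A \<and> card (B j) = s" "disjoint_family_on B {..<k}"
proof (cases "k = 0 \<or> s = 0")
  case True
  then show thesis
    by (intro that[of "\<lambda>_. {}"]) (auto simp: disjoint_family_on_def)
next
  case False
  \<comment> \<open>An infinite set has \<open>card\<close> equal to 0, which the hypothesis
    excludes once \<open>k\<close> and \<open>s\<close> are positive.\<close>
  then have "finite A"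
    using assms card.infinite by fastforce
  then obtain f where f: "bij_betw f {0..<card A} A"
    using ex_bij_betw_nat_finite by blast
  define B where "B = (\<lambda>j. f ` {j * s..<Suc j * s})"
  have le: "Suc j * s \<le> card A" if "j < k" for j
    using that assms mult_le_mono1[of "Suc j" k s] by linarith
  have inj: "inj_on f {0..<card A}"
    using f by (rule bij_betw_imp_inj_on)
  show thesis
  proof (rule that, intro allI impI conjI)
    fix j assume "j < k"
    have sub: "{j * s..<Suc j * s} \<subseteq> {0..<card A}"
      using le[OF \<open>j < k\<close>] by auto
    then show "B j \<subseteq> A"
      using bij_betw_imp_surj_on[OF f] unfolding B_def by blast
    show "card (B j) = s"
      unfolding B_def using card_image[OF inj_on_subset[OF inj sub]] by simp
  next
    show "disjoint_family_on B {..<k}"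
      unfolding disjoint_family_on_def
    proof (intro ballI impI)
      fix i j assume ij: "i \<in> {..<k}" "j \<in> {..<k}" "i \<noteq> j"
      have "Suc i * s \<le> j * s \<or> Suc j * s \<le> i * s"
        using ij(3) by (metis Suc_leI linorder_neq_iff mult_le_mono1)
      then have "{i * s..<Suc i * s} \<inter> {j * s..<Suc j * s} = {}"
        by auto
      moreover have "{i * s..<Suc i * s} \<subseteq> {0..<card A}" "{j * s..<Suc j * s} \<subseteq> {0..<card A}"
        using le[of i] le[of j] ij by auto
      ultimately show "B i \<inter> B j = {}"
        unfolding B_def using inj_on_image_Int[OF inj] by (metis image_empty)
    qed
  qed
qed

text \<open>\<open>R\<close> is chosen before \<open>X\<close> because the tester does not know the
  non-outliers; all randomness is in the permutation. A failure forces some block to be mapped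
  entirely outside \<open>X\<close>, and the union bound over blocks gives the factor
  \<open>k\<close>.\<close>

lemma exists_hitting_sample:
  assumes "finite A" "A \<noteq> {}" "k * s \<le> card A"
  shows "\<exists>R\<subseteq>A. card R \<le> k * s \<and> (\<forall>X\<subseteq>A. (1 - \<epsilon>) * real (card A) \<le> real (card X) \<and> k \<le> card X \<longrightarrow>
    measure_pmf.prob (pmf_of_set {\<sigma>. \<sigma> permutes A}) {\<sigma>. card (\<sigma> ` R \<inter> X) < k}
      \<le> real k * \<epsilon> ^ s)"
proof -
  let ?p = "pmf_of_set {\<sigma>. \<sigma> permutes A}"
  obtain B where "\<forall>j<k. B j \<subseteq> A \<and> card (B j) = s" "disjoint_family_on B {..<k}"
    using exists_disjoint_blocks[OF assms(3)] .
  then have B: "\<And>j. j < k \<Longrightarrow> B j \<subseteq> A" "\<And>j. j < k \<Longrightarrow> card (B j) = s"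
    "disjoint_family_on B {..<k}"
    by auto
  define R where "R = (\<Union>j<k. B j)"
  have finB: "finite (B j)" if "j < k" for j
    using B(1)[OF that] assms(1) finite_subset by blast
  have "card R \<le> (\<Sum>j<k. card (B j))"
    unfolding R_def by (rule card_UN_le) simp
  then have "card R \<le> k * s"
    using B(2) by simp
  moreover have "R \<subseteq> A"
    using B(1) by (auto simp: R_def)
  moreover have "measure_pmf.prob ?p {\<sigma>. card (\<sigma> ` R \<inter> X) < k} \<le> real k * \<epsilon> ^ s"
    if X: "X \<subseteq> A" "(1 - \<epsilon>) * real (card A) \<le> real (card X)" for X
  proof -
    have "real (card (A - X)) = real (card A) - real (card X)"
      using X(1) assms(1) by (simp add: card_Diff_subset finite_subset of_nat_diff card_mono)
    then have frac: "real (card (A - X)) / real (card A) \<le> \<epsilon>"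
      using X(2) assms(1,2) by (simp add: divide_le_eq card_gt_0_iff algebra_simps)
    \<comment> \<open>From each block a point landing in \<open>X\<close> is chosen; disjointness of
      the blocks and injectivity of \<open>\<sigma>\<close> keep the \<open>k\<close> images
      distinct.\<close>
    have hit: "k \<le> card (\<sigma> ` R \<inter> X)"
      if \<sigma>: "\<sigma> permutes A" and meets: "\<And>j. j < k \<Longrightarrow> \<not> \<sigma> ` B j \<subseteq> A - X" for \<sigma>
    proof -
      have "\<exists>b\<in>B j. \<sigma> b \<in> X" if "j < k" for j
        using meets[OF that] B(1)[OF that] permutes_in_image[OF \<sigma>] by blast
      then obtain b where b: "\<And>j. j < k \<Longrightarrow> b j \<in> B j \<and> \<sigma> (b j) \<in> X"
        by metis
      have "inj_on (\<lambda>j. \<sigma> (b j)) {..<k}"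
      proof (rule inj_onI)
        fix i j assume ij: "i \<in> {..<k}" "j \<in> {..<k}" "\<sigma> (b i) = \<sigma> (b j)"
        then have "b i = b j"
          using permutes_inj[OF \<sigma>] by (meson injD)
        then have "b i \<in> B i \<inter> B j"
          using b[of i] b[of j] ij by simp
        then show "i = j"
          using B(3) ij unfolding disjoint_family_on_def by blast
      qed
      moreover have "(\<lambda>j. \<sigma> (b j)) ` {..<k} \<subseteq> \<sigma> ` R \<inter> X"
        using b by (auto simp: R_def)
      moreover have "finite (\<sigma> ` R \<inter> X)"
        using finB by (simp add: R_def)
      ultimately show ?thesis
        using card_inj_on_le[of "\<lambda>j. \<sigma> (b j)" "{..<k}"] by simp
    qed
    have ne: "{\<sigma>. \<sigma> permutes A} \<noteq> {}" "finite {\<sigma>. \<sigma> permutes A}"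
      using permutes_id finite_permutations[OF assms(1)] by blast+
    have "measure_pmf.prob ?p {\<sigma>. card (\<sigma> ` R \<inter> X) < k}
        \<le> measure_pmf.prob ?p (\<Union>j<k. {\<sigma>. \<sigma> ` B j \<subseteq> A - X})"
    \<comment> \<open>The inclusion of events relies on \<open>\<sigma>\<close> being a permutation,
      so it is claimed only almost surely.\<close>
    proof (rule measure_pmf.finite_measure_mono_AE)
      show "AE \<sigma> in ?p. \<sigma> \<in> {\<sigma>. card (\<sigma> ` R \<inter> X) < k}
          \<longrightarrow> \<sigma> \<in> (\<Union>j<k. {\<sigma>. \<sigma> ` B j \<subseteq> A - X})"
        unfolding AE_measure_pmf_iff set_pmf_of_set[OF ne]
      proof (intro ballI impI)
        fix \<sigma> assume "\<sigma> \<in> {\<sigma>. \<sigma> permutes A}" "\<sigma> \<in> {\<sigma>. card (\<sigma> ` R \<inter> X) < k}"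
        then show "\<sigma> \<in> (\<Union>j<k. {\<sigma>. \<sigma> ` B j \<subseteq> A - X})"
          using hit[of \<sigma>] by (simp add: Bex_def) (meson not_le)
      qed
    qed simp
    also have "\<dots> \<le> (\<Sum>j<k. measure_pmf.prob ?p {\<sigma>. \<sigma> ` B j \<subseteq> A - X})"
      by (rule measure_pmf.finite_measure_subadditive_finite) auto
    also have "\<dots> \<le> (\<Sum>j<k. \<epsilon> ^ s)"
    proof (rule sum_mono)
      fix j assume "j \<in> {..<k}"
      then have "j < k" by simp
      have "measure_pmf.prob ?p {\<sigma>. \<sigma> ` B j \<subseteq> A - X}
          \<le> (real (card (A - X)) / real (card A)) ^ card (B j)"
        by (rule prob_permutation_image_subset[OF assms(1,2) B(1)[OF \<open>j < k\<close>]]) simp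
      also have "\<dots> \<le> \<epsilon> ^ s"
        unfolding B(2)[OF \<open>j < k\<close>] using frac by (intro power_mono) auto
      finally show "measure_pmf.prob ?p {\<sigma>. \<sigma> ` B j \<subseteq> A - X} \<le> \<epsilon> ^ s" .
    qed
    finally show ?thesis
      by simp
  qed
  ultimately show ?thesis
    by blast
qed

section \<open>Agents drawn with replacement\<close>

lemma pmf_map_True: "pmf (map_pmf Q p) True = measure_pmf.prob p {x. Q x}"
  by (simp add: pmf_map vimage_def)

lemma prob_replicate_pmf_ball:
  "pmf (map_pmf (\<lambda>xs. \<forall>x\<in>set xs. Q x) (replicate_pmf q p)) True = measure_pmf.prob p {x. Q x} ^ q"
proof (induction q)
  case (Suc q)
  have "pmf (map_pmf (\<lambda>xs. \<forall>x\<in>set xs. Q x) (replicate_pmf (Suc q) p)) True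
      = pmf (bind_pmf p (\<lambda>x. map_pmf (\<lambda>xs. Q x \<and> (\<forall>x\<in>set xs. Q x)) (replicate_pmf q p))) True"
    by (simp add: map_pmf_def bind_assoc_pmf bind_return_pmf)
  also have "\<dots> = measure_pmf.expectation p
      (\<lambda>x. pmf (map_pmf (\<lambda>xs. Q x \<and> (\<forall>x\<in>set xs. Q x)) (replicate_pmf q p)) True)"
    by (rule pmf_bind)
  also have "\<dots> = measure_pmf.expectation p
      (\<lambda>x. measure_pmf.prob p {x. Q x} ^ q * indicator {x. Q x} x)"
    by (intro Bochner_Integration.integral_cong)
      (auto simp flip: Suc.IH simp: indicator_def pmf_map_True)
  also have "\<dots> = measure_pmf.prob p {x. Q x} ^ Suc q"
    by simp
  finally show ?case .
qed simp

text \<open>\<open>1 - x \<le> exp (- x)\<close> is applied to the fraction \<open>x\<close> of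
  agents violating \<open>Q\<close>. The result is written as a product over agents because, for a
  random profile, its factors are independent.\<close>

lemma prob_draws_le:
  assumes "n > 0"
  shows "measure_pmf.prob (pmf_of_set {..<n}) {i. Q i} ^ q
    \<le> (\<Prod>i<n. if Q i then 1 else exp (- (real q / real n)))"
proof -
  have ne: "{..<n} \<noteq> {}"
    using assms by auto
  have "real (card {i \<in> {..<n}. Q i}) + real (card {i \<in> {..<n}. \<not> Q i}) = real n"
    using card_Un_disjoint[of "{i \<in> {..<n}. Q i}" "{i \<in> {..<n}. \<not> Q i}"]
    by (simp add: Collect_disj_eq[symmetric] Collect_conj_eq[symmetric] conj_disj_distribL[symmetric]
        flip: of_nat_add)
  then have "measure_pmf.prob (pmf_of_set {..<n}) {i. Q i}
      = 1 - real (card {i \<in> {..<n}. \<not> Q i}) / real n"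
    using assms measure_pmf_of_set[OF ne finite_lessThan, of "{i. Q i}"]
    by (simp add: field_simps Int_def)
  also have "\<dots> \<le> exp (- (real (card {i \<in> {..<n}. \<not> Q i}) / real n))"
    using exp_ge_add_one_self[of "- (real (card {i \<in> {..<n}. \<not> Q i}) / real n)"] by simp
  finally have "measure_pmf.prob (pmf_of_set {..<n}) {i. Q i} ^ q
      \<le> exp (- (real (card {i \<in> {..<n}. \<not> Q i}) / real n)) ^ q"
    by (intro power_mono) auto
  also have "\<dots> = exp (- (real q / real n)) ^ card {i \<in> {..<n}. \<not> Q i}"
    by (simp add: exp_of_nat_mult[symmetric] mult.commute)
  also have "\<dots> = (\<Prod>i<n. if Q i then 1 else exp (- (real q / real n)))"
    by (simp add: prod.If_cases Int_def)
  finally show ?thesis .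
qed

text \<open>\<open>exp t \<ge> 1 + t\<close> bounds \<open>exp (- t)\<close> by
  \<open>1 / (1 + t)\<close>, and \<open>(1 + t) * (1 - t / 2) \<ge> 1\<close> because
  \<open>t * t \<le> t\<close>.\<close>

lemma one_minus_exp_ge:
  fixes t :: real
  assumes "0 \<le> t" "t \<le> 1"
  shows "t / 2 \<le> 1 - exp (- t)"
proof -
  have "exp (- t) \<le> 1 / (1 + t)"
    using exp_ge_add_one_self[of t] assms by (simp add: exp_minus field_simps)
  also have "1 / (1 + t) \<le> 1 - t / 2"
    using assms mult_left_mono[of t 1 t] by (simp add: field_simps)
  finally show ?thesis
    by simp
qed

text \<open>
  Given the profile, all draws avoid \<open>S\<close> with probability at most \<open>exp (- q N / n)\<close>, where \<open>N\<close> is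
  the number of agents in \<open>S\<close>. The expectation over the profile factorizes, and \<open>q \<le> n\<close> keeps each
  exponent \<open>q / n\<close> in the range where \<open>exp\<close> is comparable to its linear approximation.
\<close>

lemma prob_draws_avoid_le:
  assumes "n > 0" "q \<le> n"
  shows "pmf (bind_pmf (Pi_pmf {..<n} d (\<lambda>_. p))
      (\<lambda>P. map_pmf (\<lambda>js. \<forall>i\<in>set js. P i \<notin> S) (replicate_pmf q (pmf_of_set {..<n})))) True
    \<le> exp (- (measure_pmf.prob p S * real q / 2))"
proof -
  define t where "t = real q / real n"
  have t: "0 \<le> t" "t \<le> 1"
    using assms by (auto simp: t_def)
  let ?PP = "Pi_pmf {..<n} d (\<lambda>_. p)"
  let ?f = "\<lambda>r. if r \<notin> S then 1 else exp (- t)"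
  have int: "integrable (measure_pmf p) ?f"
    using t by (intro measure_pmf.integrable_const_bound[where B = 1]) auto
  have fle: "0 \<le> (\<Prod>i<n. ?f (P i))" "(\<Prod>i<n. ?f (P i)) \<le> 1" for P :: "nat \<Rightarrow> 'a"
    using t by (auto intro!: prod_nonneg prod_le_1)
  have "pmf (bind_pmf ?PP
      (\<lambda>P. map_pmf (\<lambda>js. \<forall>i\<in>set js. P i \<notin> S) (replicate_pmf q (pmf_of_set {..<n})))) True
    = measure_pmf.expectation ?PP
        (\<lambda>P. measure_pmf.prob (pmf_of_set {..<n}) {i. P i \<notin> S} ^ q)"
    by (simp add: pmf_bind prob_replicate_pmf_ball)
  also have "\<dots> \<le> measure_pmf.expectation ?PP (\<lambda>P. \<Prod>i<n. ?f (P i))"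
  proof (rule integral_mono)
    show "integrable (measure_pmf ?PP) (\<lambda>P. measure_pmf.prob (pmf_of_set {..<n}) {i. P i \<notin> S} ^ q)"
      by (intro measure_pmf.integrable_const_bound[where B = 1]) (auto simp: power_le_one)
    show "integrable (measure_pmf ?PP) (\<lambda>P. \<Prod>i<n. ?f (P i))"
      using fle by (intro measure_pmf.integrable_const_bound[where B = 1]) (auto simp: abs_le_iff intro: order_trans[of _ 0])
    show "measure_pmf.prob (pmf_of_set {..<n}) {i. P i \<notin> S} ^ q \<le> (\<Prod>i<n. ?f (P i))" for P
      unfolding t_def by (rule prob_draws_le[OF assms(1)])
  qed
  also have "\<dots> = (\<Prod>i<n. measure_pmf.expectation p ?f)"
    using int t by (intro expectation_prod_Pi_pmf) auto
  also have "measure_pmf.expectation p ?f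
      = measure_pmf.expectation p (\<lambda>r. 1 - (1 - exp (- t)) * indicator S r)"
    by (intro Bochner_Integration.integral_cong) (auto simp: indicator_def)
  also have "\<dots> = 1 - (1 - exp (- t)) * measure_pmf.prob p S"
    by (subst Bochner_Integration.integral_diff)
      (simp_all add: integrable_real_indicator measure_pmf.emeasure_finite less_top[symmetric])
  also have "(\<Prod>i<n. 1 - (1 - exp (- t)) * measure_pmf.prob p S)
      = (1 - (1 - exp (- t)) * measure_pmf.prob p S) ^ n"
    by simp
  \<comment> \<open>The lower bound \<open>t / 2\<close> for \<open>1 - exp (- t)\<close> is the
    source of the factor 1/2 in the final exponent, where \<open>n * t = q\<close>.\<close>
  also have "\<dots> \<le> exp (- (t / 2 * measure_pmf.prob p S)) ^ n"
  proof (rule power_mono)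
    have "t / 2 * measure_pmf.prob p S \<le> (1 - exp (- t)) * measure_pmf.prob p S"
      using one_minus_exp_ge[OF t] by (intro mult_right_mono) auto
    then show "1 - (1 - exp (- t)) * measure_pmf.prob p S \<le> exp (- (t / 2 * measure_pmf.prob p S))"
      using exp_ge_add_one_self[of "- (t / 2 * measure_pmf.prob p S)"] by linarith
    have "(1 - exp (- t)) * measure_pmf.prob p S \<le> 1 * 1"
      using t by (intro mult_mono) auto
    then show "0 \<le> 1 - (1 - exp (- t)) * measure_pmf.prob p S"
      by simp
  qed
  also have "\<dots> = exp (- (measure_pmf.prob p S * real q / 2))"
    using assms(1) by (simp add: exp_of_nat_mult[symmetric] t_def field_simps)
  finally show ?thesis .
qed

text \<open>Restricting to \<open>Y\<close> inside lets \<open>W\<close> hold orders of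
  \<open>R\<close> or of all alternatives, with the same verdict. If a finite \<open>R\<close> has
  fewer than \<open>k\<close> elements there is no candidate \<open>Y\<close>, and the tester
  rejects.\<close>

definition misses_order :: "nat \<Rightarrow> 'a set \<Rightarrow> 'a rel set \<Rightarrow> bool" where
  "misses_order k R W \<longleftrightarrow>
     (\<exists>Y\<subseteq>R. card Y = k \<and> \<not> linear_orders Y \<subseteq> (\<lambda>r. Restr r Y) ` W)"

text \<open>There are \<open>(card R choose k) * fact k \<le> card R ^ k\<close> pairs of a
  \<open>k\<close>-subset and an order of it, and a uniform preference shows a given order with
  probability \<open>1 / fact k\<close>, whence the exponent.\<close>

lemma prob_random_profile_misses_order_le:
  assumes "finite A" "R \<subseteq> A" "n > 0" "q \<le> n"
  shows "pmf (bind_pmf (random_profile A n) (\<lambda>P.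
      map_pmf (\<lambda>js. misses_order k R ((\<lambda>i. Restr (P i) R) ` set js))
        (replicate_pmf q (pmf_of_set {..<n})))) True
    \<le> real (card R) ^ k * exp (- (real q / (2 * fact k)))"
proof -
  define F where "F = (SIGMA Y:{Y. Y \<subseteq> R \<and> card Y = k}. linear_orders Y)"
  \<comment> \<open>\<open>J\<close> is the law of the set of drawn preferences over both profile
    and draws, so that the union bound takes place under a single measure.\<close>
  define J where "J = bind_pmf (random_profile A n)
    (\<lambda>P. map_pmf (\<lambda>js. P ` set js) (replicate_pmf q (pmf_of_set {..<n})))"
  have finR: "finite R"
    using assms(1,2) finite_subset by blast
  have finY: "finite Y" if "Y \<subseteq> R" for Y
    using that finR finite_subset by blast
  have finF: "finite F"
    unfolding F_def using finR finY finite_linear_orders by (intro finite_SigmaI) auto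
  have "card F = (\<Sum>Y | Y \<subseteq> R \<and> card Y = k. card (linear_orders Y))"
    unfolding F_def using finR finY finite_linear_orders by (intro card_SigmaI) auto
  also have "\<dots> = (\<Sum>Y | Y \<subseteq> R \<and> card Y = k. fact k)"
    using finY by (intro sum.cong) (auto simp: card_linear_orders)
  also have "\<dots> = (card R choose k) * fact k"
    using n_subsets[OF finR, of k] by simp
  also have "\<dots> \<le> card R ^ k"
    by (rule binomial_fact_pow)
  finally have "real (card F) \<le> real (card R ^ k)"
    by (rule of_nat_mono)
  then have cardF: "real (card F) \<le> real (card R) ^ k"
    by simp
  have miss: "misses_order k R ((\<lambda>i. Restr (P i) R) ` I) \<longleftrightarrow>
      P ` I \<in> (\<Union>(Y, \<omega>)\<in>F. {W. \<omega> \<notin> (\<lambda>r. Restr r Y) ` W})" for P :: "nat \<Rightarrow> 'a rel" and I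
  proof -
    have "(\<lambda>r. Restr r Y) ` (\<lambda>i. Restr (P i) R) ` I = (\<lambda>r. Restr r Y) ` P ` I" if "Y \<subseteq> R" for Y
      unfolding image_image Restr_Restr_subset[OF that] ..
    then have "misses_order k R ((\<lambda>i. Restr (P i) R) ` I) \<longleftrightarrow> misses_order k R (P ` I)"
      unfolding misses_order_def by (metis (no_types, lifting))
    then show ?thesis
      by (simp add: misses_order_def F_def subset_iff Bex_def)
  qed
  have "pmf (bind_pmf (random_profile A n) (\<lambda>P.
      map_pmf (\<lambda>js. misses_order k R ((\<lambda>i. Restr (P i) R) ` set js))
        (replicate_pmf q (pmf_of_set {..<n})))) True
    = pmf (map_pmf (\<lambda>W. W \<in> (\<Union>(Y, \<omega>)\<in>F. {W. \<omega> \<notin> (\<lambda>r. Restr r Y) ` W})) J) True"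
    unfolding J_def miss by (simp only: map_bind_pmf pmf.map_comp o_def)
  also have "\<dots> = measure_pmf.prob J (\<Union>(Y, \<omega>)\<in>F. {W. \<omega> \<notin> (\<lambda>r. Restr r Y) ` W})"
    by (simp only: pmf_map_True Collect_mem_eq)
  also have "\<dots> \<le> (\<Sum>x\<in>F. measure_pmf.prob J (case x of (Y, \<omega>) \<Rightarrow> {W. \<omega> \<notin> (\<lambda>r. Restr r Y) ` W}))"
    using finF by (intro measure_pmf.finite_measure_subadditive_finite) auto
  also have "\<dots> \<le> (\<Sum>x\<in>F. exp (- (real q / (2 * fact k))))"
  proof (rule sum_mono)
    fix x assume "x \<in> F"
    then obtain Y \<omega> where x: "x = (Y, \<omega>)" and Y: "Y \<subseteq> R" "card Y = k" "\<omega> \<in> linear_orders Y"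
      by (auto simp: F_def)
    have avoid: "\<omega> \<notin> (\<lambda>r. Restr r Y) ` P ` I \<longleftrightarrow> (\<forall>i\<in>I. P i \<notin> {r. Restr r Y = \<omega>})"
      for P :: "nat \<Rightarrow> 'a rel" and I
      by (auto simp: image_image)
    have "measure_pmf.prob J {W. \<omega> \<notin> (\<lambda>r. Restr r Y) ` W}
        = pmf (bind_pmf (random_profile A n) (\<lambda>P. map_pmf
            (\<lambda>js. \<forall>i\<in>set js. P i \<notin> {r. Restr r Y = \<omega>}) (replicate_pmf q (pmf_of_set {..<n})))) True"
      unfolding J_def pmf_map_True[symmetric]
      by (simp only: map_bind_pmf pmf.map_comp o_def avoid)
    also have "\<dots> \<le> exp (- (1 / fact k * real q / 2))"
      using prob_draws_avoid_le[OF assms(3,4), of "{}" "pmf_of_set (linear_orders A)" "{r. Restr r Y = \<omega>}"]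
        prob_linear_orders_Restr[OF assms(1) order_trans[OF Y(1) assms(2)] Y(3)] Y(2)
      unfolding random_profile_def by simp
    finally show "measure_pmf.prob J (case x of (Y, \<omega>) \<Rightarrow> {W. \<omega> \<notin> (\<lambda>r. Restr r Y) ` W})
        \<le> exp (- (real q / (2 * fact k)))"
      by (simp add: x mult.commute)
  qed
  also have "\<dots> \<le> real (card R) ^ k * exp (- (real q / (2 * fact k)))"
    using cardF by simp
  finally show ?thesis .
qed

section \<open>The tester\<close>

text \<open>If \<open>A\<close> is too small for \<open>k\<close> disjoint blocks,
  \<open>R = A\<close> works: its image under a permutation is \<open>A\<close>, which contains all
  of \<open>X\<close>, so \<open>k \<le> card X\<close> rules out failure.\<close>

lemma exists_sample:
  assumes "finite A" "A \<noteq> {}" "0 \<le> \<epsilon>"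
  shows "\<exists>R\<subseteq>A. card R \<le> k * s \<and>
    (\<forall>X\<subseteq>A. (1 - \<epsilon>) * real (card A) \<le> real (card X) \<and> k \<le> card X \<longrightarrow>
      measure_pmf.prob (pmf_of_set {\<sigma>. \<sigma> permutes A}) {\<sigma>. card (\<sigma> ` R \<inter> X) < k} \<le> real k * \<epsilon> ^ s)"
proof (cases "k * s \<le> card A")
  case True
  then show ?thesis
    by (rule exists_hitting_sample[OF assms(1,2)])
next
  case False
  have ne: "{\<sigma>. \<sigma> permutes A} \<noteq> {}" "finite {\<sigma>. \<sigma> permutes A}"
    using permutes_id finite_permutations[OF assms(1)] by blast+
  have "measure_pmf.prob (pmf_of_set {\<sigma>. \<sigma> permutes A}) {\<sigma>. card (\<sigma> ` A \<inter> X) < k} \<le> real k * \<epsilon> ^ s"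
    if "X \<subseteq> A" "k \<le> card X" for X
  proof -
    have "A \<inter> X = X"
      using that(1) by blast
    then have "{\<sigma>. \<sigma> permutes A} \<inter> {\<sigma>. card (\<sigma> ` A \<inter> X) < k} = {}"
      using that(2) by (auto simp: permutes_image)
    then have "measure_pmf.prob (pmf_of_set {\<sigma>. \<sigma> permutes A}) {\<sigma>. card (\<sigma> ` A \<inter> X) < k} = 0"
      using measure_pmf_of_set[OF ne] by simp
    then show ?thesis
      using assms(3) by simp
  qed
  then show ?thesis
    using False by (intro exI[of _ A]) auto
qed

text \<open>On a \<open>k\<close>-subset \<open>Y\<close> of \<open>R \<inter> X\<close> the
  restricted profile belongs to \<open>D\<close> by normality. Content below 1 leaves fewer than
  \<open>fact k\<close> orders for all agents together, so some order of \<open>Y\<close> is absent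
  whichever agents are drawn.\<close>

lemma outlier_misses_order:
  fixes D :: "'a rel set set"
  assumes "normal D" "domain_content D k < 1" "k \<ge> 2"
    and "finite A" "is_profile A n P" "X \<subseteq> A" "belongs_to D n (restrict_profile P X)"
    and "k \<le> card (R \<inter> X)" "I \<subseteq> {..<n}"
  shows "misses_order k R ((\<lambda>i. Restr (P i) R) ` I)"
proof -
  obtain Y where Y: "Y \<subseteq> R \<inter> X" "card Y = k" "finite Y"
    using assms(8) obtain_subset_with_card_n by metis
  have ne: "Y \<noteq> {}"
    using Y assms(3) by auto
  have finX: "finite X"
    using assms(4,6) finite_subset by blast
  have "is_profile X n (restrict_profile P X)"
    using assms(5,6) unfolding is_profile_def restrict_profile_def by (blast intro: Restr_linear_orders)
  moreover have "restrict_profile (restrict_profile P X) Y = restrict_profile P Y"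
    unfolding restrict_profile_def using Restr_Restr_subset[of Y X] Y(1) by auto
  ultimately have bel: "belongs_to D n (restrict_profile P Y)"
    using assms(1,7) finX Y(1) ne unfolding normal_def by (metis le_inf_iff)
  have prof: "is_profile Y n (restrict_profile P Y)"
    using assms(5,6) Y(1) Restr_linear_orders[of _ A Y]
    unfolding is_profile_def restrict_profile_def by blast
  define N where "N = {card (P ` {..<n}) | (A :: 'a set) n P.
    finite A \<and> card A = k \<and> is_profile A n P \<and> belongs_to D n P}"
  \<comment> \<open>A supremum of naturals is guaranteed to be an upper bound only for a bounded
    set; the bound is the number of orders of \<open>k\<close> alternatives.\<close>
  have "bdd_above N"
  proof (rule bdd_aboveI[of _ "fact k"])
    fix x assume "x \<in> N"
    then obtain A :: "'a set" and n P where *: "x = card (P ` {..<n})" "finite A" "card A = k" "is_profile A n P"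
      unfolding N_def by blast
    have "P ` {..<n} \<subseteq> linear_orders A"
      using *(4) unfolding is_profile_def by auto
    then have "card (P ` {..<n}) \<le> card (linear_orders A)"
      by (intro card_mono finite_linear_orders *(2))
    then show "x \<le> fact k"
      using * by (simp add: card_linear_orders)
  qed
  moreover have "card (restrict_profile P Y ` {..<n}) \<in> N"
    unfolding N_def using Y(2,3) prof bel by blast
  ultimately have "card (restrict_profile P Y ` {..<n}) \<le> Sup N"
    by (rule cSup_upper[rotated])
  \<comment> \<open>\<open>k \<ge> 2\<close> selects the branch of \<open>domain_content\<close>
    given by the supremum.\<close>
  moreover have "real (Sup N) / fact k < 1"
    using assms(2,3) unfolding domain_content_def N_def by simp
  then have "real (Sup N) < real (fact k)"
    by simp
  then have "Sup N < fact k"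
    by (simp only: of_nat_less_iff)
  ultimately have less: "card (restrict_profile P Y ` {..<n}) < card (linear_orders Y)"
    using Y by (simp add: card_linear_orders)
  have "(\<lambda>r. Restr r Y) ` (\<lambda>i. Restr (P i) R) ` I = restrict_profile P Y ` I"
    using Y(1) unfolding image_image restrict_profile_def by (subst Restr_Restr_subset) auto
  also have "\<dots> \<subseteq> restrict_profile P Y ` {..<n}"
    using assms(9) by blast
  finally have "\<not> linear_orders Y \<subseteq> (\<lambda>r. Restr r Y) ` (\<lambda>i. Restr (P i) R) ` I"
    using less card_mono[of "restrict_profile P Y ` {..<n}" "linear_orders Y"]
    by (meson finite_imageI finite_lessThan not_le order_trans)
  then show ?thesis
    unfolding misses_order_def using Y(1,2) by blast
qed

section \<open>The algorithm, its cost and its two error probabilities\<close>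

lemma run_Toss_map_pmf: "run n P (Toss (map_pmf f p)) r = bind_pmf p (\<lambda>x. run n P (f x) r)"
  by (simp add: bind_eq_join_pmf pmf.map_comp o_def)

text \<open>One random permutation applied to a fixed list serves as the random choice of
  alternatives. It is tossed once, before any agent is drawn.\<close>

definition tester :: "'a set \<Rightarrow> 'a list \<Rightarrow> nat \<Rightarrow> nat \<Rightarrow> 'a algorithm" where
  "tester A xs k q = Toss (map_pmf
     (\<lambda>\<sigma>. sample_query (map \<sigma> xs) (misses_order k (\<sigma> ` set xs)) q {})
     (pmf_of_set {\<sigma>. \<sigma> permutes A}))"

lemma sample_complexity_tester:
  assumes "finite A" "set xs \<subseteq> A" "length xs \<le> 2 ^ d"
  shows "sample_complexity_le A (tester A xs k q) (real (q * (length xs * d)))"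
  unfolding sample_complexity_le_def
proof (intro allI impI ballI)
  fix n P x assume nP: "n > 0" "is_profile A n P" and "x \<in> set_pmf (run n P (tester A xs k q) {})"
  moreover have "set_pmf (pmf_of_set {\<sigma>. \<sigma> permutes A}) = {\<sigma>. \<sigma> permutes A}"
    using permutes_id finite_permutations[OF assms(1)] by (intro set_pmf_of_set) blast+
  ultimately obtain \<sigma> where \<sigma>: "\<sigma> permutes A" and
    x: "x \<in> set_pmf (run n P (sample_query (map \<sigma> xs) (misses_order k (\<sigma> ` set xs)) q {}) {})"
    by (auto simp: tester_def run_Toss_map_pmf simp del: run.simps)
  have "set (map \<sigma> xs) \<subseteq> A"
    using assms(2) permutes_in_image[OF \<sigma>] by auto
  then have "snd x \<le> q * (length (map \<sigma> xs) * d)"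
    using sample_query_cost[OF nP(2) _ _ nP(1), of "map \<sigma> xs" d "fst x" "snd x"] x assms(3) by simp
  then show "case x of (b, c) \<Rightarrow> real c \<le> real (q * (length xs * d))"
    by (simp add: case_prod_unfold flip: of_nat_mult)
qed

lemma sample_complexity_le_mono:
  assumes "sample_complexity_le A T c" "c \<le> c'"
  shows "sample_complexity_le A T c'"
  unfolding sample_complexity_le_def
proof (intro allI impI ballI)
  fix n P x assume "n > 0" "is_profile A n P" "x \<in> set_pmf (run n P T {})"
  then have "case x of (b, k) \<Rightarrow> real k \<le> c"
    using assms(1) unfolding sample_complexity_le_def by blast
  then show "case x of (b, k) \<Rightarrow> real k \<le> c'"
    using assms(2) by (cases x) simp
qed

lemma output_dist_tester:
  assumes "finite A" "set xs \<subseteq> A" "n > 0" "is_profile A n P"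
  shows "output_dist n P (tester A xs k q) =
    bind_pmf (pmf_of_set {\<sigma>. \<sigma> permutes A}) (\<lambda>\<sigma>.
      map_pmf (\<lambda>js. misses_order k (\<sigma> ` set xs) ((\<lambda>i. Restr (P i) (\<sigma> ` set xs)) ` set js))
        (replicate_pmf q (pmf_of_set {..<n})))"
proof -
  have set: "set_pmf (pmf_of_set {\<sigma>. \<sigma> permutes A}) = {\<sigma>. \<sigma> permutes A}"
    using permutes_id finite_permutations[OF assms(1)] by (intro set_pmf_of_set) blast+
  have "output_dist n P (tester A xs k q) = bind_pmf (pmf_of_set {\<sigma>. \<sigma> permutes A}) (\<lambda>\<sigma>.
      map_pmf fst (run n P (sample_query (map \<sigma> xs) (misses_order k (\<sigma> ` set xs)) q {}) {}))"
    by (simp only: output_dist_def tester_def run_Toss_map_pmf map_bind_pmf)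
  also have "\<dots> = bind_pmf (pmf_of_set {\<sigma>. \<sigma> permutes A}) (\<lambda>\<sigma>.
      map_pmf (\<lambda>js. misses_order k (\<sigma> ` set xs) ((\<lambda>i. Restr (P i) (\<sigma> ` set xs)) ` set js))
        (replicate_pmf q (pmf_of_set {..<n})))"
  proof (rule bind_pmf_cong[OF refl])
    fix \<sigma> assume "\<sigma> \<in> set_pmf (pmf_of_set {\<sigma>. \<sigma> permutes A})"
    then have "\<sigma> permutes A"
      by (simp add: set)
    then have "set (map \<sigma> xs) \<subseteq> A"
      using assms(2) permutes_in_image by fastforce
    from sample_query_output[OF assms(4) this assms(3)]
    show "map_pmf fst (run n P (sample_query (map \<sigma> xs) (misses_order k (\<sigma> ` set xs)) q {}) {}) =
      map_pmf (\<lambda>js. misses_order k (\<sigma> ` set xs) ((\<lambda>i. Restr (P i) (\<sigma> ` set xs)) ` set js))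
        (replicate_pmf q (pmf_of_set {..<n}))"
      by simp
  qed
  finally show ?thesis .
qed

lemma is_profile_random_profile:
  assumes "finite A" "P \<in> set_pmf (random_profile A n)"
  shows "is_profile A n P"
  using assms set_pmf_of_set[OF linear_orders_nonempty finite_linear_orders]
  unfolding is_profile_def random_profile_def by (auto simp: set_Pi_pmf PiE_dflt_def)

text \<open>\<open>large\<close> controls the error on outlier profiles, where the sample may
  contain too few non-outliers; \<open>small\<close> controls the error on random profiles, where
  some order may go unseen.\<close>

lemma is_tester_tester:
  fixes A :: "'a set"
  assumes D: "normal D" "domain_content D k < 1" "k \<ge> 2"
    and A: "finite A" "set xs \<subseteq> A" and n: "n > 0" "q \<le> n"
    and large: "\<And>X. X \<subseteq> A \<Longrightarrow> (1 - \<epsilon>) * real (card A) \<le> real (card X) \<Longrightarrow>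
      measure_pmf.prob (pmf_of_set {\<sigma>. \<sigma> permutes A}) {\<sigma>. card (\<sigma> ` set xs \<inter> X) < k} \<le> \<delta>"
    and small: "real (card (set xs)) ^ k * exp (- (real q / (2 * fact k))) \<le> \<delta>"
  shows "is_tester \<epsilon> \<delta> D A n (tester A xs k q)"
  unfolding is_tester_def
proof (intro conjI allI impI)
  let ?p = "pmf_of_set {\<sigma>. \<sigma> permutes A}"
  define out :: "(nat \<Rightarrow> 'a rel) \<Rightarrow> ('a \<Rightarrow> 'a) \<Rightarrow> bool pmf" where "out = (\<lambda>P \<sigma>.
    map_pmf (\<lambda>js. misses_order k (\<sigma> ` set xs) ((\<lambda>i. Restr (P i) (\<sigma> ` set xs)) ` set js))
      (replicate_pmf q (pmf_of_set {..<n})))"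
  have set: "set_pmf ?p = {\<sigma>. \<sigma> permutes A}"
    using permutes_id finite_permutations[OF A(1)] by (intro set_pmf_of_set) blast+
  have out: "output_dist n P (tester A xs k q) = bind_pmf ?p (out P)" if "is_profile A n P" for P
    unfolding out_def by (rule output_dist_tester[OF A n(1) that])
  {
    fix P assume "outlier_profile \<epsilon> D A n P"
    then obtain X where P: "is_profile A n P" and X: "X \<subseteq> A" "(1 - \<epsilon>) * real (card A) \<le> real (card X)"
      "belongs_to D n (restrict_profile P X)"
      unfolding outlier_profile_def by blast
    \<comment> \<open>Once the permuted sample has \<open>k\<close> elements in \<open>X\<close>,
      acceptance is certain for any draws, so all error of this kind comes from the
      permutation.\<close>
    have le: "pmf (out P \<sigma>) False \<le> indicator {\<sigma>. card (\<sigma> ` set xs \<inter> X) < k} \<sigma>" for \<sigma>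
    proof (cases "card (\<sigma> ` set xs \<inter> X) < k")
      case False
      have "misses_order k (\<sigma> ` set xs) ((\<lambda>i. Restr (P i) (\<sigma> ` set xs)) ` set js)"
        if "js \<in> set_pmf (replicate_pmf q (pmf_of_set {..<n}))" for js
      proof (rule outlier_misses_order[OF D A(1) P X(1,3)])
        show "set js \<subseteq> {..<n}"
          using that n(1) set_pmf_of_set[of "{..<n}"]
          by (auto simp: set_replicate_pmf lessThan_empty_iff)
      qed (use False in simp)
      then have "False \<notin> set_pmf (out P \<sigma>)"
        by (auto simp: out_def)
      then have "pmf (out P \<sigma>) False = 0"
        by (simp only: pmf_eq_0_set_pmf simp_thms)
      then show ?thesis
        by simp
    qed (simp add: pmf_le_1)
    have "pmf (output_dist n P (tester A xs k q)) False
        = measure_pmf.expectation ?p (\<lambda>\<sigma>. pmf (out P \<sigma>) False)"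
      by (simp add: out[OF P] pmf_bind)
    also have "\<dots> \<le> measure_pmf.expectation ?p (indicator {\<sigma>. card (\<sigma> ` set xs \<inter> X) < k})"
      using le by (intro integral_mono measure_pmf.integrable_const_bound[where B = 1])
        (auto simp: pmf_le_1 indicator_def)
    also have "\<dots> = measure_pmf.prob ?p {\<sigma>. card (\<sigma> ` set xs \<inter> X) < k}"
      by simp
    also have "\<dots> \<le> \<delta>"
      by (rule large[OF X(1,2)])
    finally show "pmf (output_dist n P (tester A xs k q)) False \<le> \<delta>" .
  }
  have "bind_pmf (random_profile A n) (\<lambda>P. output_dist n P (tester A xs k q))
      = bind_pmf (random_profile A n) (\<lambda>P. bind_pmf ?p (out P))"
    using out is_profile_random_profile[OF A(1)] by (intro bind_pmf_cong refl) blast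
  \<comment> \<open>Profile and permutation are independent; exchanging them fixes the sample before
    averaging over the profile, as the bound for random profiles requires.\<close>
  also have "\<dots> = bind_pmf ?p (\<lambda>\<sigma>. bind_pmf (random_profile A n) (\<lambda>P. out P \<sigma>))"
    by (rule bind_commute_pmf)
  finally have "pmf (bind_pmf (random_profile A n) (\<lambda>P. output_dist n P (tester A xs k q))) True
      = measure_pmf.expectation ?p (\<lambda>\<sigma>. pmf (bind_pmf (random_profile A n) (\<lambda>P. out P \<sigma>)) True)"
    by (simp add: pmf_bind)
  also have "\<dots> \<le> measure_pmf.expectation ?p (\<lambda>\<sigma>. \<delta>)"
  proof (rule integral_mono_AE)
    show "integrable ?p (\<lambda>\<sigma>. pmf (bind_pmf (random_profile A n) (\<lambda>P. out P \<sigma>)) True)"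
      by (intro measure_pmf.integrable_const_bound[where B = 1]) (auto simp: pmf_le_1)
    show "AE \<sigma> in ?p. pmf (bind_pmf (random_profile A n) (\<lambda>P. out P \<sigma>)) True \<le> \<delta>"
      unfolding AE_measure_pmf_iff set
    proof
      fix \<sigma> assume "\<sigma> \<in> {\<sigma>. \<sigma> permutes A}"
      then have \<sigma>: "\<sigma> permutes A"
        by simp
      have "\<sigma> ` set xs \<subseteq> A"
        using A(2) permutes_in_image[OF \<sigma>] by auto
      from prob_random_profile_misses_order_le[OF A(1) this n, of k]
      have "pmf (bind_pmf (random_profile A n) (\<lambda>P. out P \<sigma>)) True
          \<le> real (card (set xs)) ^ k * exp (- (real q / (2 * fact k)))"
        unfolding out_def card_image[OF permutes_inj_on[OF \<sigma>]] .
      then show "pmf (bind_pmf (random_profile A n) (\<lambda>P. out P \<sigma>)) True \<le> \<delta>"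
        using small by linarith
    qed
  qed simp
  finally show "pmf (bind_pmf (random_profile A n) (\<lambda>P. output_dist n P (tester A xs k q))) True \<le> \<delta>"
    by simp
qed

section \<open>Choice of the parameters\<close>

lemma log_ratio_ge: "log_ratio \<epsilon> \<delta> \<ge> 2"
  by (simp add: log_ratio_def)

text \<open>In logarithms, \<open>ln k + ln (1 / \<delta>)\<close> has to be at most
  \<open>s * ln (1 / \<epsilon>)\<close>. As \<open>\<delta> < 1/2\<close> gives
  \<open>ln (1 / \<delta>) \<ge> ln 2\<close>, the factor \<open>k\<close> of the union bound over
  blocks is absorbed as \<open>log 2 k\<close> further multiples of
  \<open>ln (1 / \<delta>)\<close>.\<close>

lemma power_log_ratio_le:
  fixes k :: nat and \<epsilon> \<delta> :: real
  assumes "k \<ge> 1" "0 < \<epsilon>" "\<epsilon> < 1" "0 < \<delta>" "\<delta> < 1/2"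
    and "(1 + log 2 k) * log_ratio \<epsilon> \<delta> \<le> real s"
  shows "real k * \<epsilon> ^ s \<le> \<delta>"
proof -
  define u where "u = ln (1 / \<epsilon>)"
  have u: "u > 0" "ln \<epsilon> = - u"
    using assms(2,3) by (simp_all add: u_def ln_div)
  have \<delta>: "ln (1 / \<delta>) \<ge> ln 2"
    using assms(4,5) by (intro ln_mono) (auto simp: field_simps)
  have k: "ln (real k) \<ge> 0" "log 2 k \<ge> 0"
    using assms(1) by auto
  have "ln (real k) + ln (1 / \<delta>) \<le> ln (real k) / ln 2 * ln (1 / \<delta>) + ln (1 / \<delta>)"
    using mult_left_mono[OF \<delta>, of "ln (real k) / ln 2"] k by simp
  also have "\<dots> = (1 + log 2 k) * ln (1 / \<delta>)"
    by (simp add: log_def algebra_simps)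
  also have "\<dots> = (1 + log 2 k) * (log (1 / \<epsilon>) (1 / \<delta>) * u)"
    using u by (simp add: log_def u_def)
  also have "\<dots> \<le> (1 + log 2 k) * (log_ratio \<epsilon> \<delta> * u)"
    using k u by (intro mult_left_mono mult_right_mono) (auto simp: log_ratio_def)
  also have "\<dots> \<le> real s * u"
    using mult_right_mono[OF assms(6), of u] u by (simp add: mult.assoc)
  finally have "ln (real k) - real s * u \<le> ln \<delta>"
    using assms(4) by (simp add: ln_div)
  then have "exp (ln (real k) - real s * u) \<le> exp (ln \<delta>)"
    by simp
  moreover have "exp (ln (real k) - real s * u) = real k * \<epsilon> ^ s"
  proof -
    have "\<epsilon> ^ s = exp (- (real s * u))"
      using assms(2) u by (simp add: exp_of_nat_mult[symmetric] powr_realpow[symmetric] powr_def)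
    then show ?thesis
      using assms(1) by (simp add: exp_diff exp_minus field_simps)
  qed
  ultimately show ?thesis
    using assms(4) by simp
qed

text \<open>In logarithms, the union bound costs \<open>k * ln r\<close> with
  \<open>ln r \<le> ln b + ln L\<close>. Since \<open>ln (L / \<delta>) \<ge> 1\<close>, the
  constant \<open>ln b\<close> is absorbed into a multiple of
  \<open>ln (L / \<delta>)\<close>.\<close>

lemma power_exp_le:
  fixes r k q :: nat and b L \<delta> :: real
  assumes "k \<ge> 1" "1 \<le> b" "1 \<le> L" "0 < \<delta>" "\<delta> < 1" "exp 1 \<le> L / \<delta>"
    and "real r \<le> b * L" "2 * fact k * real k * (1 + ln b) * ln (L / \<delta>) \<le> real q"
  shows "real r ^ k * exp (- (real q / (2 * fact k))) \<le> \<delta>"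
proof (cases "r = 0")
  case True
  then show ?thesis
    using assms(1,4) by (simp add: power_0_left)
next
  case False
  have "ln (exp 1) \<le> ln (L / \<delta>)"
    using assms(6) by (intro ln_mono) auto
  then have one: "1 \<le> ln (L / \<delta>)"
    by simp
  have "ln (real r) \<le> ln (b * L)"
    using assms(7) False by (intro ln_mono) auto
  also have "\<dots> = ln b + ln L"
    using assms(2,3) by (simp add: ln_mult)
  finally have "real k * ln (real r) + ln (1 / \<delta>) \<le> real k * (ln b + ln L) + real k * ln (1 / \<delta>)"
    using assms(1,4,5) mult_right_mono[of 1 "real k" "ln (1 / \<delta>)"]
    by (intro add_mono mult_left_mono) auto
  also have "\<dots> = real k * (ln b * 1 + ln (L / \<delta>))"
    using assms(3,4) by (simp add: ln_div algebra_simps)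
  also have "\<dots> \<le> real k * (ln b * ln (L / \<delta>) + ln (L / \<delta>))"
    using one assms(2) by (intro mult_left_mono add_mono) auto
  also have "\<dots> \<le> real q / (2 * fact k)"
    using assms(8) by (simp add: field_simps)
  finally have le: "real k * ln (real r) - real q / (2 * fact k) \<le> ln \<delta>"
    using assms(4) by (simp add: ln_div)
  have "real r ^ k = exp (real k * ln (real r))"
    using False by (simp add: exp_of_nat_mult)
  then have "real r ^ k * exp (- (real q / (2 * fact k))) = exp (real k * ln (real r) - real q / (2 * fact k))"
    by (simp only: exp_add[symmetric] diff_conv_add_uminus)
  also have "\<dots> \<le> exp (ln \<delta>)"
    using le by simp
  finally show ?thesis
    using assms(4) by simp
qed

lemma of_nat_ceiling_le_add_one: "0 \<le> x \<Longrightarrow> real (nat \<lceil>x\<rceil>) \<le> x + 1"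
  by linarith

text \<open>Rounding up \<open>log 2 (b * L)\<close> gives at most \<open>log 2 L\<close> plus a
  constant, and \<open>log 2 L \<ge> 1\<close> turns the constant into a factor. Here the lower
  bound 2 in \<open>log_ratio\<close> matters.\<close>

lemma exists_pow2_ge:
  fixes r :: nat and b L :: real
  assumes "1 \<le> b" "2 \<le> L" "real r \<le> b * L"
  shows "\<exists>d. r \<le> 2 ^ d \<and> real d \<le> (log 2 b + 2) / ln 2 * ln L"
proof -
  define d where "d = nat \<lceil>log 2 (b * L)\<rceil>"
  have bL: "1 \<le> b * L"
    using mult_mono[of 1 b 1 L] assms(1,2) by simp
  then have log0: "0 \<le> log 2 (b * L)"
    by simp
  have "real r \<le> 2 powr log 2 (b * L)"
    using bL assms(3) by simp
  also have "\<dots> \<le> 2 powr real d"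
    unfolding d_def by (intro powr_mono) linarith+
  also have "\<dots> = real (2 ^ d)"
    by (simp add: powr_realpow)
  finally have "r \<le> 2 ^ d"
    by (simp only: of_nat_le_iff)
  moreover have "real d \<le> (log 2 b + 2) / ln 2 * ln L"
  proof -
    have "1 \<le> log 2 L" "0 \<le> log 2 b"
      using assms(1,2) by (simp_all add: le_log_iff)
    then have "log 2 b + 1 \<le> (log 2 b + 1) * log 2 L"
      using mult_left_mono[of 1 "log 2 L" "log 2 b + 1"] by simp
    moreover have "real d \<le> log 2 b + log 2 L + 1"
      using of_nat_ceiling_le_add_one[OF log0] assms(1,2) by (simp add: d_def log_mult)
    ultimately have "real d \<le> (log 2 b + 2) * log 2 L"
      by (simp add: algebra_simps)
    then show ?thesis
      by (simp add: log_def)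
  qed
  ultimately show ?thesis
    by blast
qed

text \<open>Makes the logarithm of the right-hand side at least 1, so that rounding up the number of
  draws costs only a constant factor.\<close>

lemma exp_one_le_log_ratio_div:
  assumes "0 < \<delta>" "\<delta> < 1/2"
  shows "exp 1 \<le> log_ratio \<epsilon> \<delta> / \<delta>"
proof -
  have "exp 1 \<le> (4 :: real)"
    using exp_le by simp
  also have "4 * \<delta> \<le> log_ratio \<epsilon> \<delta>"
    using assms log_ratio_ge[of \<epsilon> \<delta>] by linarith
  then have "4 \<le> log_ratio \<epsilon> \<delta> / \<delta>"
    using assms by (simp add: field_simps)
  finally show ?thesis .
qed

lemma exists_tester:
  fixes D :: "'a rel set set"
  assumes D: "normal D" "domain_content D k < 1" "k \<ge> 2"
  shows "\<exists>C>(0 :: real). \<exists>c>(0 :: real). \<forall>(A :: 'a set) (\<epsilon> :: real) (\<delta> :: real).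
    finite A \<and> A \<noteq> {} \<and> 0 < \<epsilon> \<and> \<epsilon> < 1 \<and> 0 < \<delta> \<and> \<delta> < 1/2 \<and>
    k \<le> nat \<lceil>(1 - \<epsilon>) * real (card A)\<rceil> \<longrightarrow>
    (\<exists>T :: 'a algorithm.
       sample_complexity_le A T
         (C * (ln (log_ratio \<epsilon> \<delta> / \<delta>) * log_ratio \<epsilon> \<delta> * ln (log_ratio \<epsilon> \<delta>))) \<and>
       (\<forall>n :: nat. real n \<ge> c * ln (log_ratio \<epsilon> \<delta> / \<delta>) \<longrightarrow> is_tester \<epsilon> \<delta> D A n T))"
proof -
  \<comment> \<open>All constants depend on \<open>k\<close> only. \<open>a\<close> is the factor of
    \<open>L\<close> that \<open>power_log_ratio_le\<close> asks of the block size,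
    \<open>b * L\<close> bounds the sample size, \<open>c\<close> is the factor of
    \<open>ln (L / \<delta>)\<close> that \<open>power_exp_le\<close> asks of the number of draws,
    and \<open>e * ln L\<close> bounds the cost of an insertion.\<close>
  define a where "a = 1 + log 2 (real k)"
  define b where "b = real k * (a + 1)"
  define c where "c = 2 * fact k * real k * (1 + ln b)"
  define e where "e = (log 2 b + 2) / ln 2"
  have a: "a \<ge> 1"
    using D(3) by (simp add: a_def)
  have b: "b \<ge> 1"
    unfolding b_def using mult_mono[of 1 "real k" 1 "a + 1"] D(3) a by simp
  have c: "c > 0"
    unfolding c_def using D(3) b by (intro mult_pos_pos) (auto intro: add_pos_nonneg)
  have e: "e > 0"
    unfolding e_def using b by (intro divide_pos_pos) (auto intro: add_nonneg_pos)
  show ?thesis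
  \<comment> \<open>The first witness multiplies the bounds for draws, sample size and insertion
    cost. Using \<open>c + 1\<close> absorbs the rounding of \<open>q\<close>; as a threshold for
    \<open>n\<close> it ensures \<open>q \<le> n\<close>.\<close>
  proof (rule exI[of _ "(c + 1) * (b * e)"], intro conjI, use b c e in simp,
      rule exI[of _ "c + 1"], intro conjI allI impI, use c in simp)
    fix A :: "'a set" and \<epsilon> \<delta> :: real
    assume "finite A \<and> A \<noteq> {} \<and> 0 < \<epsilon> \<and> \<epsilon> < 1 \<and> 0 < \<delta> \<and> \<delta> < 1/2 \<and>
      k \<le> nat \<lceil>(1 - \<epsilon>) * real (card A)\<rceil>"
    then have A: "finite A" "A \<noteq> {}" and \<epsilon>: "0 < \<epsilon>" "\<epsilon> < 1" and \<delta>: "0 < \<delta>" "\<delta> < 1/2"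
      and k: "k \<le> nat \<lceil>(1 - \<epsilon>) * real (card A)\<rceil>"
      by auto
    define L where "L = log_ratio \<epsilon> \<delta>"
    have L: "L \<ge> 2"
      unfolding L_def by (rule log_ratio_ge)
    have expL: "exp 1 \<le> L / \<delta>"
      unfolding L_def by (rule exp_one_le_log_ratio_div[OF \<delta>])
    have "ln (exp 1) \<le> ln (L / \<delta>)"
      using expL by (intro ln_mono) auto
    then have lnL: "1 \<le> ln (L / \<delta>)"
      by simp
    define s where "s = nat \<lceil>a * L\<rceil>"
    define q where "q = nat \<lceil>c * ln (L / \<delta>)\<rceil>"
    have s: "a * L \<le> real s" "real s \<le> (a + 1) * L"
      using of_nat_ceiling_le_add_one[of "a * L"] a L by (auto simp: s_def algebra_simps real_nat_ceiling_ge)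
    have q: "c * ln (L / \<delta>) \<le> real q" "real q \<le> (c + 1) * ln (L / \<delta>)"
      using of_nat_ceiling_le_add_one[of "c * ln (L / \<delta>)"] c lnL
      by (auto simp: q_def algebra_simps real_nat_ceiling_ge)
    obtain R where R: "R \<subseteq> A" "card R \<le> k * s" and
      hit: "\<forall>X\<subseteq>A. (1 - \<epsilon>) * real (card A) \<le> real (card X) \<and> k \<le> card X \<longrightarrow>
        measure_pmf.prob (pmf_of_set {\<sigma>. \<sigma> permutes A}) {\<sigma>. card (\<sigma> ` R \<inter> X) < k} \<le> real k * \<epsilon> ^ s"
      using exists_sample[OF A less_imp_le[OF \<epsilon>(1)]] by metis
    obtain xs where xs: "set xs = R" "distinct xs"
      using finite_distinct_list[OF finite_subset[OF R(1) A(1)]] by blast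
    have len: "length xs = card R"
      using distinct_card[OF xs(2)] xs(1) by simp
    have "real (card R) \<le> real (k * s)"
      using R(2) by (rule of_nat_mono)
    also have "\<dots> \<le> real k * ((a + 1) * L)"
      using s(2) by (simp add: mult_left_mono)
    finally have cardR: "real (card R) \<le> b * L"
      by (simp add: b_def mult.assoc)
    obtain d where d: "length xs \<le> 2 ^ d" "real d \<le> e * ln L"
      using exists_pow2_ge[OF b L cardR] unfolding len e_def by blast
    show "\<exists>T. sample_complexity_le A T ((c + 1) * (b * e) *
          (ln (log_ratio \<epsilon> \<delta> / \<delta>) * log_ratio \<epsilon> \<delta> * ln (log_ratio \<epsilon> \<delta>))) \<and>
        (\<forall>n. (c + 1) * ln (log_ratio \<epsilon> \<delta> / \<delta>) \<le> real n \<longrightarrow> is_tester \<epsilon> \<delta> D A n T)"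
      unfolding L_def[symmetric]
    proof (intro exI[of _ "tester A xs k q"] conjI allI impI)
      have "real (q * (length xs * d)) = real q * (real (card R) * real d)"
        by (simp add: len)
      also have "\<dots> \<le> ((c + 1) * ln (L / \<delta>)) * ((b * L) * (e * ln L))"
        using q(2) cardR d(2) b c L lnL e by (intro mult_mono) auto
      finally have "real (q * (length xs * d)) \<le> (c + 1) * (b * e) * (ln (L / \<delta>) * L * ln L)"
        by (simp add: mult_ac)
      then show "sample_complexity_le A (tester A xs k q) ((c + 1) * (b * e) * (ln (L / \<delta>) * L * ln L))"
        using sample_complexity_le_mono[OF sample_complexity_tester[OF A(1) _ d(1)]] R(1) xs(1)
        by simp
    next
      fix n :: nat assume n: "(c + 1) * ln (L / \<delta>) \<le> real n"
      have "0 < real q"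
        using q(1) c lnL by (smt (verit) mult_pos_pos)
      moreover have "real q \<le> real n"
        using q(2) n by linarith
      ultimately have qn: "n > 0" "q \<le> n"
        by auto
      show "is_tester \<epsilon> \<delta> D A n (tester A xs k q)"
      proof (rule is_tester_tester[OF D A(1) _ qn])
        show "set xs \<subseteq> A"
          using xs R by simp
        show "real (card (set xs)) ^ k * exp (- (real q / (2 * fact k))) \<le> \<delta>"
          using power_exp_le[of k b L \<delta> "card R" q] D(3) b L \<delta> expL cardR q(1)
          unfolding xs(1) c_def by simp
        fix X assume X: "X \<subseteq> A" "(1 - \<epsilon>) * real (card A) \<le> real (card X)"
        \<comment> \<open>\<open>card X\<close> is an integer, so it is at least the ceiling of
          \<open>(1 - \<epsilon>) * card A\<close>.\<close>
        have "k \<le> card X"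
          using k X(2) by linarith
        then have "measure_pmf.prob (pmf_of_set {\<sigma>. \<sigma> permutes A}) {\<sigma>. card (\<sigma> ` R \<inter> X) < k}
            \<le> real k * \<epsilon> ^ s"
          using hit X by blast
        also have "\<dots> \<le> \<delta>"
          using power_log_ratio_le[of k \<epsilon> \<delta> s] D(3) \<epsilon> \<delta> s(1) unfolding a_def L_def by simp
        finally show "measure_pmf.prob (pmf_of_set {\<sigma>. \<sigma> permutes A})
            {\<sigma>. card (\<sigma> ` set xs \<inter> X) < k} \<le> \<delta>"
          unfolding xs(1) .
      qed
    qed
  qed
qed

theorem corollary3p11:
  fixes D :: "'a rel set set"
  assumes "is_domain D" and "normal D" and "neutral D"
  shows "\<exists>C>(0 :: real). \<exists>c>(0 :: real). \<forall>(A :: 'a set) (\<epsilon> :: real) (\<delta> :: real).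
    finite A \<and> A \<noteq> {} \<and> 0 < \<epsilon> \<and> \<epsilon> < 1 \<and> 0 < \<delta> \<and> \<delta> < 1/2 \<and>
    domain_content D (nat \<lceil>(1 - \<epsilon>) * real (card A)\<rceil>) < 1 \<longrightarrow>
    (\<exists>T :: 'a algorithm.
       sample_complexity_le A T
         (C * (ln (log_ratio \<epsilon> \<delta> / \<delta>) * log_ratio \<epsilon> \<delta> * ln (log_ratio \<epsilon> \<delta>))) \<and>
       (\<forall>n :: nat. real n \<ge> c * ln (log_ratio \<epsilon> \<delta> / \<delta>) \<longrightarrow> is_tester \<epsilon> \<delta> D A n T))"
proof -
  have pos: "nat \<lceil>(1 - \<epsilon>) * real (card A)\<rceil> > 0" if "finite A" "A \<noteq> {}" "\<epsilon> < 1"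
    for A :: "'a set" and \<epsilon> :: real
    using that by (simp add: card_gt_0_iff)
  show ?thesis
  proof (cases "\<exists>k>0. domain_content D k < 1")
    \<comment> \<open>No instance satisfies the hypothesis on the content, so any positive constants
      will do.\<close>
    case False
    then have "\<not> domain_content D (nat \<lceil>(1 - \<epsilon>) * real (card A)\<rceil>) < 1"
      if "finite A" "A \<noteq> {}" "\<epsilon> < 1" for A :: "'a set" and \<epsilon> :: real
      using pos[OF that] by blast
    then show ?thesis
      by (meson zero_less_one)
  next
    case True
    \<comment> \<open>The argument of the content varies with \<open>A\<close> and
      \<open>\<epsilon>\<close>, but the constants must not. The least \<open>k\<close> depends on
      \<open>D\<close> only and is at most every such argument.\<close>
    define k where "k = (LEAST k. k > 0 \<and> domain_content D k < 1)"
    have k: "k > 0" "domain_content D k < 1"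
      using LeastI_ex[OF True] by (simp_all add: k_def)
    \<comment> \<open>The content at 1 is 1 by definition.\<close>
    then have "k \<ge> 2"
      by (cases "k = 1") (auto simp: domain_content_def)
    have least: "k \<le> j" if "j > 0" "domain_content D j < 1" for j
      unfolding k_def using that by (intro Least_le) simp
    from exists_tester[OF assms(2) k(2) \<open>k \<ge> 2\<close>] obtain C c :: real where C: "C > 0" "c > 0"
      "\<forall>(A :: 'a set) (\<epsilon> :: real) (\<delta> :: real).
        finite A \<and> A \<noteq> {} \<and> 0 < \<epsilon> \<and> \<epsilon> < 1 \<and> 0 < \<delta> \<and> \<delta> < 1/2 \<and>
        k \<le> nat \<lceil>(1 - \<epsilon>) * real (card A)\<rceil> \<longrightarrow>
        (\<exists>T :: 'a algorithm.
           sample_complexity_le A T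
             (C * (ln (log_ratio \<epsilon> \<delta> / \<delta>) * log_ratio \<epsilon> \<delta> * ln (log_ratio \<epsilon> \<delta>))) \<and>
           (\<forall>n :: nat. real n \<ge> c * ln (log_ratio \<epsilon> \<delta> / \<delta>) \<longrightarrow> is_tester \<epsilon> \<delta> D A n T))"
      by (elim exE conjE)
    show ?thesis
    proof (rule exI[of _ C], rule conjI[OF C(1)], rule exI[of _ c], rule conjI[OF C(2)],
        intro allI impI)
      fix A :: "'a set" and \<epsilon> \<delta> :: real
      assume "finite A \<and> A \<noteq> {} \<and> 0 < \<epsilon> \<and> \<epsilon> < 1 \<and> 0 < \<delta> \<and> \<delta> < 1/2 \<and>
        domain_content D (nat \<lceil>(1 - \<epsilon>) * real (card A)\<rceil>) < 1"
      then have A: "finite A" "A \<noteq> {}" and \<epsilon>: "0 < \<epsilon>" "\<epsilon> < 1" and \<delta>: "0 < \<delta>" "\<delta> < 1/2"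
        and content: "domain_content D (nat \<lceil>(1 - \<epsilon>) * real (card A)\<rceil>) < 1"
        by auto
      show "\<exists>T. sample_complexity_le A T
            (C * (ln (log_ratio \<epsilon> \<delta> / \<delta>) * log_ratio \<epsilon> \<delta> * ln (log_ratio \<epsilon> \<delta>))) \<and>
          (\<forall>n :: nat. real n \<ge> c * ln (log_ratio \<epsilon> \<delta> / \<delta>) \<longrightarrow> is_tester \<epsilon> \<delta> D A n T)"
        by (intro C(3)[rule_format] conjI A \<epsilon> \<delta> least[OF pos[OF A \<epsilon>(2)] content])
    qed
  qed
qed

end
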